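(* The system $Y=(\mathrm{PFO},\to_{\{P\downarrow,S\downarrow,M\}})/\stackrel{*}{\leftrightarrow}_{ACO}$ is terminating. Moreover, there exists a polynomial-time algorithm that, given a pfo-formula $\phi$, returns a pfo-formula $\phi^+$ such that $[\phi^+]_{ACO}$ is a normal form of $[\phi]_{ACO}$ in the system $Y$.
   Context: All formulas are relational first-order formulas; $\wedge,\vee$ are binary. A pfo-formula is a first-order formula with no negation; $\mathrm{PFO}$ is the class of all pfo-formulas; $\mathrm{free}(\psi)$ is the set of free variables of $\psi$. Rewriting rules (applicable to any subformula occurrence; $\oplus\in\{\wedge,\vee\}$, $Q\in\{\exists,\forall\}$): $A$: $F_1\oplus(F_2\oplus F_3)\to(F_1\oplus F_2)\oplus F_3$ and its converse; $C$: $F_1\oplus F_2\to F_2\oplus F_1$; $O$: $QxQyF\to QyQxF$; $P\!\downarrow$: $\exists x(F_1\wedge F_2)\to(\exists xF_1)\wedge F_2$ and $\forall x(F_1\vee F_2)\to(\forall xF_1)\vee F_2$ whenever $x\notin\mathrm{free}(F_2)$; $S\!\downarrow$: $\exists x(F_1\vee F_2)\to(\exists xF_1)\vee(\exists xF_2)$ and $\forall x(F_1\wedge F_2)\to(\forall xF_1)\wedge(\forall xF_2)$; $M$: $QxF\to F$ when $x\notin\mathrm{free}(F)$. For a set $\mathcal{R}$ of rules, $\to_{\mathcal{R}}$ is the union of the $\to_R$, $R\in\mathcal{R}$; $\stackrel{*}{\leftrightarrow}_{\mathcal{R}}$ is the reflexive-transitive closure of $\to_{\mathcal{R}}$ together with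 its inverse; $[\phi]_{\mathcal{R}}$ is the $\stackrel{*}{\leftrightarrow}_{\mathcal{R}}$-class of $\phi$. A system is a pair $(D,\to)$ of a set and a binary relation on it; it is terminating if there is no infinite chain $d_0\to d_1\to\cdots$; $e$ is a normal form of $d$ if $d\stackrel{*}{\to}e$ (reflexive-transitive closure) and there is no $e'$ with $e\to e'$. For an equivalence relation $\equiv$ on $D$, $(D,\to)/\equiv$ is the system whose elements are the $\equiv$-classes, with $C\to C'$ iff there exist $d\in C$, $d'\in C'$ with $d\to d'$. *)

theory Defs
  imports Main
begin

section \<open>Relational first-order formulas\<close>

datatype binop = Conj | Disj

datatype quant = Ex | All

text \<open>Variables and relation symbols are named by natural numbers. The \<open>k\<close>-ary relation symbols are
  the pairs of a name and the number \<open>k\<close>, so \<open>Atom R xs\<close> applies the symbol named \<open>R\<close> of arity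
  \<open>length xs\<close>. Every purely relational vocabulary with countably many symbols embeds into this one,
  and no rewriting rule changes an atom.\<close>

datatype fo =
    Atom nat "nat list"
  | Neg fo
  | Bin binop fo fo
  | Qu quant nat fo

primrec free :: "fo \<Rightarrow> nat set" where
  "free (Atom R xs) = set xs"
| "free (Neg F) = free F"
| "free (Bin b F G) = free F \<union> free G"
| "free (Qu q x F) = free F - {x}"

primrec pfo :: "fo \<Rightarrow> bool" where
  "pfo (Atom R xs) \<longleftrightarrow> True"
| "pfo (Neg F) \<longleftrightarrow> False"
| "pfo (Bin b F G) \<longleftrightarrow> pfo F \<and> pfo G"
| "pfo (Qu q x F) \<longleftrightarrow> pfo F"

definition PFO :: "fo set" where
  "PFO = {F. pfo F}"


section \<open>Rewriting rules\<close>

datatype rule = rule_A | rule_C | rule_O | rule_Pdown | rule_Sdown | rule_M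

inductive root_step :: "rule \<Rightarrow> fo \<Rightarrow> fo \<Rightarrow> bool" where
  A1: "root_step rule_A (Bin b F1 (Bin b F2 F3)) (Bin b (Bin b F1 F2) F3)"
| A2: "root_step rule_A (Bin b (Bin b F1 F2) F3) (Bin b F1 (Bin b F2 F3))"
| C: "root_step rule_C (Bin b F1 F2) (Bin b F2 F1)"
| O: "root_step rule_O (Qu q x (Qu q y F)) (Qu q y (Qu q x F))"
| P_Ex: "x \<notin> free F2 \<Longrightarrow>
    root_step rule_Pdown (Qu Ex x (Bin Conj F1 F2)) (Bin Conj (Qu Ex x F1) F2)"
| P_All: "x \<notin> free F2 \<Longrightarrow>
    root_step rule_Pdown (Qu All x (Bin Disj F1 F2)) (Bin Disj (Qu All x F1) F2)"
| S_Ex: "root_step rule_Sdown (Qu Ex x (Bin Disj F1 F2)) (Bin Disj (Qu Ex x F1) (Qu Ex x F2))"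
| S_All: "root_step rule_Sdown (Qu All x (Bin Conj F1 F2)) (Bin Conj (Qu All x F1) (Qu All x F2))"
| M: "x \<notin> free F \<Longrightarrow> root_step rule_M (Qu q x F) F"

inductive rule_step :: "rule \<Rightarrow> fo \<Rightarrow> fo \<Rightarrow> bool" for r :: rule where
  root: "root_step r F G \<Longrightarrow> rule_step r F G"
| in_Neg: "rule_step r F G \<Longrightarrow> rule_step r (Neg F) (Neg G)"
| in_Bin_left: "rule_step r F G \<Longrightarrow> rule_step r (Bin b F H) (Bin b G H)"
| in_Bin_right: "rule_step r F G \<Longrightarrow> rule_step r (Bin b H F) (Bin b H G)"
| in_Qu: "rule_step r F G \<Longrightarrow> rule_step r (Qu q x F) (Qu q x G)"

definition rewr :: "rule set \<Rightarrow> fo rel" where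
  "rewr R = {(F, G). \<exists>r\<in>R. rule_step r F G}"

definition conv :: "rule set \<Rightarrow> fo rel" where
  "conv R = (rewr R \<union> (rewr R)\<inverse>)\<^sup>*"

definition conv_class :: "rule set \<Rightarrow> fo \<Rightarrow> fo set" where
  "conv_class R F = conv R `` {F}"


section \<open>Systems\<close>

type_synonym 'a system = "'a set \<times> 'a rel"

definition terminating :: "'a system \<Rightarrow> bool" where
  "terminating S \<longleftrightarrow>
     \<not> (\<exists>d :: nat \<Rightarrow> 'a. \<forall>i. d i \<in> fst S \<and> (d i, d (Suc i)) \<in> snd S)"

definition normal_form_of :: "'a system \<Rightarrow> 'a \<Rightarrow> 'a \<Rightarrow> bool" where
  "normal_form_of S d e \<longleftrightarrow> (d, e) \<in> (snd S)\<^sup>* \<and> \<not> (\<exists>e'. (e, e') \<in> snd S)"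

definition quotient_system :: "'a system \<Rightarrow> 'a rel \<Rightarrow> 'a set system" where
  "quotient_system S E =
     (fst S // E,
      {(C, C'). C \<in> fst S // E \<and> C' \<in> fst S // E \<and> (\<exists>d\<in>C. \<exists>d'\<in>C'. (d, d') \<in> snd S)})"

definition ACO :: "rule set" where
  "ACO = {rule_A, rule_C, rule_O}"

definition system_Y :: "fo set system" where
  "system_Y =
     quotient_system (PFO, rewr {rule_Pdown, rule_Sdown, rule_M} \<inter> PFO \<times> PFO) (conv ACO)"

text \<open>\<open>conv ACO\<close> lives on all formulas; by the following lemmas it is an equivalence relation for which
  \<open>PFO\<close> is a union of classes, so the quotient above is the quotient of \<open>PFO\<close> by its restriction.\<close>

lemma equiv_conv: "equiv UNIV (conv R)"
  unfolding conv_def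
  by (intro equivI) (auto simp: refl_on_def intro!: sym_rtrancl trans_rtrancl sym_Un_converse)

lemma rule_step_pfo: "rule_step r F G \<Longrightarrow> pfo F \<longleftrightarrow> pfo G"
  by (induction rule: rule_step.induct) (auto elim!: root_step.cases)

lemma conv_PFO: "(F, G) \<in> conv R \<Longrightarrow> F \<in> PFO \<longleftrightarrow> G \<in> PFO"
  unfolding conv_def
  by (induction rule: rtrancl_induct) (auto simp: rewr_def PFO_def dest: rule_step_pfo)

lemma conv_class_subset_PFO: "F \<in> PFO \<Longrightarrow> conv_class R F \<subseteq> PFO"
  using conv_PFO by (auto simp: conv_class_def)


section \<open>Polynomial-time algorithms\<close>

text \<open>The model of computation is the imperative language WHILE over binary trees (N. D. Jones,
  Computability and Complexity, MIT Press 1997), which is polynomially equivalent to Turing machines.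
  Evaluating an expression is charged the number of nodes of the value of every subexpression, as if
  each of these trees were copied in full. Hence a run of cost \<open>t\<close> only ever handles trees of at most
  \<open>t\<close> nodes (or those present in the input) and a Turing machine simulates it in time polynomial in
  \<open>t\<close> and the input size; sharing of subtrees cannot be exploited to build large values cheaply.\<close>

datatype tree = Leaf | Node tree tree

primrec nodes :: "tree \<Rightarrow> nat" where
  "nodes Leaf = 1"
| "nodes (Node l r) = 1 + nodes l + nodes r"

type_synonym store = "nat \<Rightarrow> tree"

datatype expr =
    Var nat
  | Nil_expr
  | Cons_expr expr expr
  | Hd expr
  | Tl expr
  | Equal expr expr

primrec left :: "tree \<Rightarrow> tree" where
  "left Leaf = Leaf"
| "left (Node l r) = l"

primrec right :: "tree \<Rightarrow> tree" where
  "right Leaf = Leaf"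
| "right (Node l r) = r"

text \<open>\<open>Leaf\<close> is the truth value false, every other tree is true.\<close>

primrec eval :: "expr \<Rightarrow> store \<Rightarrow> tree" where
  "eval (Var x) s = s x"
| "eval Nil_expr s = Leaf"
| "eval (Cons_expr e1 e2) s = Node (eval e1 s) (eval e2 s)"
| "eval (Hd e) s = left (eval e s)"
| "eval (Tl e) s = right (eval e s)"
| "eval (Equal e1 e2) s = (if eval e1 s = eval e2 s then Node Leaf Leaf else Leaf)"

primrec eval_cost :: "expr \<Rightarrow> store \<Rightarrow> nat" where
  "eval_cost (Var x) s = nodes (s x)"
| "eval_cost Nil_expr s = 1"
| "eval_cost (Cons_expr e1 e2) s =
     eval_cost e1 s + eval_cost e2 s + nodes (eval (Cons_expr e1 e2) s)"
| "eval_cost (Hd e) s = eval_cost e s + nodes (eval (Hd e) s)"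
| "eval_cost (Tl e) s = eval_cost e s + nodes (eval (Tl e) s)"
| "eval_cost (Equal e1 e2) s =
     eval_cost e1 s + eval_cost e2 s + nodes (eval (Equal e1 e2) s)"

datatype com =
    Skip
  | Assign nat expr
  | Seq com com
  | If expr com com
  | While expr com

text \<open>\<open>exec c s t s'\<close>: started in store \<open>s\<close>, program \<open>c\<close> halts in store \<open>s'\<close> at total cost \<open>t\<close>.\<close>

inductive exec :: "com \<Rightarrow> store \<Rightarrow> nat \<Rightarrow> store \<Rightarrow> bool" where
  exec_Skip: "exec Skip s 1 s"
| exec_Assign: "exec (Assign x e) s (eval_cost e s) (s(x := eval e s))"
| exec_Seq: "exec c1 s t1 s' \<Longrightarrow> exec c2 s' t2 s'' \<Longrightarrow> exec (Seq c1 c2) s (t1 + t2) s''"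
| exec_If_true: "eval e s \<noteq> Leaf \<Longrightarrow> exec c1 s t s' \<Longrightarrow> exec (If e c1 c2) s (eval_cost e s + t) s'"
| exec_If_false: "eval e s = Leaf \<Longrightarrow> exec c2 s t s' \<Longrightarrow> exec (If e c1 c2) s (eval_cost e s + t) s'"
| exec_While_true: "eval e s \<noteq> Leaf \<Longrightarrow> exec c s t1 s' \<Longrightarrow> exec (While e c) s' t2 s'' \<Longrightarrow>
    exec (While e c) s (eval_cost e s + t1 + t2) s''"
| exec_While_false: "eval e s = Leaf \<Longrightarrow> exec (While e c) s (eval_cost e s) s"

lemma exec_deterministic: "exec c s t s' \<Longrightarrow> exec c s u s'' \<Longrightarrow> t = u \<and> s' = s''"
proof (induction arbitrary: u s'' rule: exec.induct)
  case (exec_While_true e s c t1 s' t2 s'')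
  from exec_While_true.prems show ?case
    by (cases rule: exec.cases) (use exec_While_true in blast)+
qed (erule exec.cases; blast)+

text \<open>Variable 0 holds the input at the start and the output at the end; all other variables start
  out as \<open>Leaf\<close>.\<close>

definition runs_to :: "com \<Rightarrow> tree \<Rightarrow> nat \<Rightarrow> tree \<Rightarrow> bool" where
  "runs_to p inp t out \<longleftrightarrow> (\<exists>s. exec p ((\<lambda>_. Leaf)(0 := inp)) t s \<and> s 0 = out)"

definition computes_in_poly_time :: "('a \<Rightarrow> tree) \<Rightarrow> 'a set \<Rightarrow> com \<Rightarrow> ('a \<Rightarrow> 'a) \<Rightarrow> bool" where
  "computes_in_poly_time enc D p f \<longleftrightarrow>
     (\<exists>c k. \<forall>x\<in>D. \<exists>t. runs_to p (enc x) t (enc (f x)) \<and> t \<le> c * nodes (enc x) ^ k + c)"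

text \<open>Numbers are encoded by their list of binary digits, least significant digit first, so the
  encoding of a formula has size linear in its length with names written in binary.\<close>

fun enc_nat :: "nat \<Rightarrow> tree" where
  "enc_nat n =
     (if n = 0 then Leaf
      else Node (if odd n then Node Leaf Leaf else Leaf) (enc_nat (n div 2)))"

declare enc_nat.simps [simp del]

primrec enc_list :: "tree list \<Rightarrow> tree" where
  "enc_list [] = Leaf"
| "enc_list (t # ts) = Node t (enc_list ts)"

primrec enc_fo :: "fo \<Rightarrow> tree" where
  "enc_fo (Atom R xs) = Node (enc_nat 0) (Node (enc_nat R) (enc_list (map enc_nat xs)))"
| "enc_fo (Neg F) = Node (enc_nat 1) (enc_fo F)"
| "enc_fo (Bin b F G) =
     Node (enc_nat (case b of Conj \<Rightarrow> 2 | Disj \<Rightarrow> 3)) (Node (enc_fo F) (enc_fo G))"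
| "enc_fo (Qu q x F) =
     Node (enc_nat (case q of Ex \<Rightarrow> 4 | All \<Rightarrow> 5)) (Node (enc_nat x) (enc_fo F))"

lemma enc_nat_eq_iff [simp]: "enc_nat m = enc_nat n \<longleftrightarrow> m = n"
proof
  show "enc_nat m = enc_nat n \<Longrightarrow> m = n"
  proof (induction m arbitrary: n rule: enc_nat.induct)
    case (1 m)
    show ?case
    proof (cases "m = 0 \<or> n = 0")
      case True
      with "1.prems" show ?thesis
        by (subst (asm) (1 2) enc_nat.simps) (auto split: if_splits)
    next
      case False
      with "1.prems" have "odd m = odd n" and "enc_nat (m div 2) = enc_nat (n div 2)"
        by (subst (asm) (1 2) enc_nat.simps, simp split: if_splits)+
      with "1.IH" False have "m div 2 = n div 2"
        by blast
      with \<open>odd m = odd n\<close> show ?thesis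
        by (metis even_two_times_div_two odd_two_times_div_two_succ)
    qed
  qed
qed simp

lemma enc_list_eq_iff [simp]: "enc_list ts = enc_list us \<longleftrightarrow> ts = us"
proof
  show "enc_list ts = enc_list us \<Longrightarrow> ts = us"
    by (induction ts arbitrary: us) (case_tac us; simp)+
qed simp

lemma inj_enc_fo: "inj enc_fo"
proof (rule injI)
  have inj_nat: "inj enc_nat"
    by (rule injI) simp
  show "enc_fo F = enc_fo G \<Longrightarrow> F = G" for F G
    by (induction F arbitrary: G)
      (case_tac G; simp add: inj_map_eq_map[OF inj_nat] split: binop.splits quant.splits)+
qed

end

theory Submission
  imports Defs
begin

text \<open>Termination: the weight that is \<open>2\<close> on atoms, \<open>a + b + 1\<close> on binary connectives and \<open>a\<^sup>2\<close> on
  quantifiers is invariant under \<open>ACO\<close>, and it drops in the other steps since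
  \<open>(a + b + 1)\<^sup>2 > a\<^sup>2 + b\<^sup>2 + 1\<close> and \<open>a\<^sup>2 > a \<ge> 2\<close>.

  Normal forms are computed bottom-up: \<open>Qu q x\<close> is pushed into a formula \<open>F\<close> in normal form. It moves
  past quantifiers of the same kind and is copied to both sides of the connective it distributes over. On
  the other connective, the components containing \<open>x\<close> are collected; if there is only one, \<open>Qu q x\<close> moves
  into it, and otherwise it stops in front of them. Being in normal form is characterised by an
  \<open>ACO\<close>-invariant predicate defined by recursion. Pushing keeps the number of atoms and adds at most
  one quantifier per atom, so sizes remain polynomial although quantifiers are duplicated.

  Hence the running time is polynomial, because a structural recursion on formulas whose values have
  polynomial size and whose recursive step is computable in polynomial time can be run on a stack.\<close>

section \<open>Poly-time computability\<close>

text \<open>A step of the quotient may start at any member of a class, so irreducibility of one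
  formula is not enough: no reordering of it may admit a step. Normality is therefore phrased
  through \<open>conn q\<close>-components, which no bracketing changes, and through whole blocks of
  like quantifiers, which \<open>rule_O\<close> permutes.

  Pushing a variable x below a like quantifier on y changes the body of the latter, so the induction
  must also show that a stuck y stays stuck. When the two sides of a connective are combined, a
  quantifier already pushed into one side may turn out to have to stop in front of both; hence the
  recursion returns the unquantified components together with their pushed form.

  Every value is charged in full. The closure properties of polynomial time therefore carry a bound
  on the size of the output next to the one on the time, and a recursion needs a size bound of its
  own, since iterated polynomial growth need not be polynomial.\<close>

definition poly_bounded :: "'a set \<Rightarrow> ('a \<Rightarrow> tree) \<Rightarrow> ('a \<Rightarrow> nat) \<Rightarrow> bool" where
  "poly_bounded D i g \<longleftrightarrow> (\<exists>k. \<forall>a\<in>D. g a \<le> Suc (nodes (i a)) ^ k)"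

lemma nodes_pos [simp]: "0 < nodes t"
  by (cases t) auto

lemma poly_boundedE:
  assumes "poly_bounded D i g"
  obtains k where "\<And>a. a \<in> D \<Longrightarrow> g a \<le> Suc (nodes (i a)) ^ k"
  using assms by (auto simp: poly_bounded_def)

lemma poly_bounded_mono:
  "poly_bounded D i g \<Longrightarrow> (\<And>a. a \<in> D' \<Longrightarrow> a \<in> D \<and> f a \<le> g a) \<Longrightarrow> poly_bounded D' i f"
  unfolding poly_bounded_def using le_trans by blast

text \<open>The base \<open>Suc (nodes (i a))\<close> is at least 2, so the exponent alone absorbs a
  constant: \<open>c \<le> 2 ^ c\<close>. This is why \<open>poly_bounded\<close> makes do with the
  single parameter \<open>k\<close>.\<close>

lemma poly_bounded_const: "poly_bounded D i (\<lambda>_. c)"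
proof -
  have "c \<le> Suc (nodes (i a)) ^ c" for a
  proof -
    have "c \<le> 2 ^ c" by (simp add: less_imp_le)
    also have "\<dots> \<le> Suc (nodes (i a)) ^ c"
      using nodes_pos[of "i a"] by (intro power_mono) linarith+
    finally show ?thesis .
  qed
  then show ?thesis by (auto simp: poly_bounded_def)
qed

lemma poly_bounded_nodes: "poly_bounded D i (\<lambda>a. nodes (i a))"
  unfolding poly_bounded_def by (intro exI[of _ 1]) auto

lemma poly_bounded_mult:
  assumes "poly_bounded D i f" "poly_bounded D i g"
  shows "poly_bounded D i (\<lambda>a. f a * g a)"
proof -
  from assms obtain k l where "\<And>a. a \<in> D \<Longrightarrow> f a \<le> Suc (nodes (i a)) ^ k"
    "\<And>a. a \<in> D \<Longrightarrow> g a \<le> Suc (nodes (i a)) ^ l"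
    by (auto simp: poly_bounded_def)
  then have "\<forall>a\<in>D. f a * g a \<le> Suc (nodes (i a)) ^ (k + l)"
    unfolding power_add by (blast intro: mult_mono zero_le)
  then show ?thesis unfolding poly_bounded_def ..
qed

text \<open>Reduced to products by \<open>f + g \<le> 2 * ((f + 1) * (g + 1))\<close>. Adding 1 at
  most doubles a bound of the form \<open>Suc (nodes (i a)) ^ k\<close>, which costs one in the
  exponent.\<close>

lemma poly_bounded_add:
  assumes "poly_bounded D i f" "poly_bounded D i g"
  shows "poly_bounded D i (\<lambda>a. f a + g a)"
proof -
  have "poly_bounded D i (\<lambda>a. 2 * ((f a + 1) * (g a + 1)))" if
    "poly_bounded D i (\<lambda>a. f a + 1)" "poly_bounded D i (\<lambda>a. g a + 1)"
    using that by (intro poly_bounded_mult poly_bounded_const)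
  moreover have "poly_bounded D i (\<lambda>a. h a + 1)" if h: "poly_bounded D i h" for h
  proof -
    from h obtain k where "\<And>a. a \<in> D \<Longrightarrow> h a \<le> Suc (nodes (i a)) ^ k"
      by (auto simp: poly_bounded_def)
    moreover have "1 \<le> Suc (nodes (i a)) ^ k" for a by (simp add: Suc_le_eq)
    moreover have "2 * Suc (nodes (i a)) ^ k \<le> Suc (nodes (i a)) ^ (k + 1)" for a
      using Suc_leI[OF nodes_pos, of "i a"] by (simp del: nodes_pos)
    ultimately have "\<forall>a\<in>D. h a + 1 \<le> Suc (nodes (i a)) ^ (k + 1)"
      by (smt (verit) add_mono le_trans mult_2)
    then show ?thesis unfolding poly_bounded_def ..
  qed
  ultimately have "poly_bounded D i (\<lambda>a. 2 * ((f a + 1) * (g a + 1)))"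
    using assms by blast
  then show ?thesis
    by (rule poly_bounded_mono) auto
qed

lemma poly_bounded_power:
  "poly_bounded D i f \<Longrightarrow> poly_bounded D i (\<lambda>a. f a ^ k)"
  by (induction k) (simp_all add: poly_bounded_mult poly_bounded_const)

lemma poly_bounded_comp:
  assumes "poly_bounded D' j g" "poly_bounded D i (\<lambda>a. nodes (j (h a)))"
    and "\<And>a. a \<in> D \<Longrightarrow> h a \<in> D'"
  shows "poly_bounded D i (\<lambda>a. g (h a))"
proof -
  obtain k where k: "\<And>b. b \<in> D' \<Longrightarrow> g b \<le> Suc (nodes (j b)) ^ k"
    using poly_boundedE[OF assms(1)] by metis
  have "poly_bounded D i (\<lambda>a. (nodes (j (h a)) + 1) ^ k)"
    by (intro poly_bounded_power poly_bounded_add poly_bounded_const assms)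
  then show ?thesis
    by (rule poly_bounded_mono) (use k assms(3) in auto)
qed

lemmas poly_bounded_intros =
  poly_bounded_const poly_bounded_nodes poly_bounded_add poly_bounded_mult

text \<open>Programs may use all variables from \<open>n\<close> on as scratch space and must not rely on their initial
  contents; this makes them composable.\<close>

definition computes_at ::
    "nat \<Rightarrow> com \<Rightarrow> 'a set \<Rightarrow> ('a \<Rightarrow> tree) \<Rightarrow> ('a \<Rightarrow> tree) \<Rightarrow> ('a \<Rightarrow> nat) \<Rightarrow> bool" where
  "computes_at n p D i f \<tau> \<longleftrightarrow> (\<forall>s. \<forall>a\<in>D. s n = i a \<longrightarrow>
     (\<exists>t s'. exec p s t s' \<and> t \<le> \<tau> a \<and> s' n = f a \<and> (\<forall>m<n. s' m = s m)))"

text \<open>A program is demanded at every offset \<open>n\<close>, so that a subprogram can be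
  placed above variables whose contents must survive. The bound on output sizes makes composition
  work: the second program is polynomial in the intermediate value.\<close>

definition poly_computable :: "'a set \<Rightarrow> ('a \<Rightarrow> tree) \<Rightarrow> ('a \<Rightarrow> tree) \<Rightarrow> bool" where
  "poly_computable D i f \<longleftrightarrow> poly_bounded D i (\<lambda>a. nodes (f a)) \<and>
     (\<forall>n. \<exists>p \<tau>. poly_bounded D i \<tau> \<and> computes_at n p D i f \<tau>)"

lemma poly_computable_nodes: "poly_computable D i f \<Longrightarrow> poly_bounded D i (\<lambda>a. nodes (f a))"
  by (simp add: poly_computable_def)

lemma computes_atD:
  assumes "computes_at n p D i f \<tau>" "a \<in> D" "s n = i a"
  obtains t s' where "exec p s t s'" "t \<le> \<tau> a" "s' n = f a" "\<And>m. m < n \<Longrightarrow> s' m = s m"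
  using assms unfolding computes_at_def by blast

lemma poly_computable_cong:
  "poly_computable D i f \<Longrightarrow> (\<And>a. a \<in> D \<Longrightarrow> f a = g a) \<Longrightarrow> poly_computable D i g"
  unfolding poly_computable_def computes_at_def poly_bounded_def by simp

lemma poly_computable_subset:
  assumes "poly_computable D i f" "D' \<subseteq> D"
  shows "poly_computable D' i f"
proof -
  have "poly_bounded D' i g" if "poly_bounded D i g" for g
    using that assms(2) by (auto elim: poly_bounded_mono)
  moreover have "computes_at n p D' i f \<tau>" if "computes_at n p D i f \<tau>" for n p \<tau>
    using that assms(2) unfolding computes_at_def by blast
  ultimately show ?thesis
    using assms(1) unfolding poly_computable_def by blast
qed

text \<open>Replaces the elements of \<open>D\<close> by tuples \<open>z\<close> that display their
  components. Such a \<open>z\<close> need not be unique, so the time bound is passed on as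
  \<open>Suc (nodes (i (r z))) ^ k\<close>, which depends on \<open>r z\<close> only.\<close>

lemma poly_computable_reparam:
  assumes "poly_computable E (\<lambda>z. i (r z)) (\<lambda>z. f (r z))" and "D \<subseteq> r ` E"
  shows "poly_computable D i f"
proof -
  have D: "\<exists>z\<in>E. a = r z" if "a \<in> D" for a using assms(2) that by auto
  have "poly_bounded D i (\<lambda>a. nodes (f a))"
  proof -
    obtain k where k: "\<And>z. z \<in> E \<Longrightarrow> nodes (f (r z)) \<le> Suc (nodes (i (r z))) ^ k"
      using poly_boundedE[OF poly_computable_nodes[OF assms(1)]] by metis
    then have "\<forall>a\<in>D. nodes (f a) \<le> Suc (nodes (i a)) ^ k"
      using D by blast
    then show ?thesis unfolding poly_bounded_def ..
  qed
  moreover have "\<exists>p \<tau>. poly_bounded D i \<tau> \<and> computes_at n p D i f \<tau>" for n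
  proof -
    from assms(1) obtain p \<tau>
      where \<tau>: "poly_bounded E (\<lambda>z. i (r z)) \<tau>"
        and p: "computes_at n p E (\<lambda>z. i (r z)) (\<lambda>z. f (r z)) \<tau>"
      unfolding poly_computable_def by blast
    obtain k where k: "\<And>z. z \<in> E \<Longrightarrow> \<tau> z \<le> Suc (nodes (i (r z))) ^ k"
      using poly_boundedE[OF \<tau>] by metis
    have "computes_at n p D i f (\<lambda>a. Suc (nodes (i a)) ^ k)"
      unfolding computes_at_def
    proof (intro allI ballI impI)
      fix s :: store and a assume "a \<in> D" and s: "s n = i a"
      with D obtain z where z: "z \<in> E" "a = r z" by blast
      obtain t s' where "exec p s t s'" "t \<le> \<tau> z" "s' n = f (r z)" "\<And>m. m < n \<Longrightarrow> s' m = s m"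
        by (rule computes_atD[where s = s, OF p z(1)]) (use s z in auto)
      with k[OF z(1)] z(2)
      show "\<exists>t s'. exec p s t s' \<and> t \<le> Suc (nodes (i a)) ^ k \<and> s' n = f a \<and> (\<forall>m<n. s' m = s m)"
        by (meson le_trans)
    qed
    moreover have "poly_bounded D i (\<lambda>a. Suc (nodes (i a)) ^ k)"
      by (auto simp: poly_bounded_def)
    ultimately show ?thesis by blast
  qed
  ultimately show ?thesis by (simp add: poly_computable_def)
qed

section \<open>Programs for the basic operations and their combination\<close>

lemma poly_computable_input: "poly_computable D i i"
proof -
  have "computes_at n Skip D i i (\<lambda>_. 1)" for n
    unfolding computes_at_def using exec_Skip by blast
  then show ?thesis
    unfolding poly_computable_def using poly_bounded_const poly_bounded_nodes by blast
qed

text \<open>One scheme for all expressions with at most two arguments: the input stays in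
  \<open>n\<close> while the arguments are computed from copies in \<open>n + 1\<close> and
  \<open>n + 2\<close>. The factor 2 is due to \<open>Cons_expr\<close>, whose arguments are charged
  on their own and again inside the result; the 3 pays for the truth value
  \<open>Node Leaf Leaf\<close>.\<close>

lemma poly_computable_expr:
  assumes f: "poly_computable D i f" and g: "poly_computable D i g"
    and ev: "\<And>u v s. eval (E u v) s = c (s u) (s v)"
    and cost: "\<And>u v s. eval_cost (E u v) s \<le> 2 * (nodes (s u) + nodes (s v)) + 3"
    and size: "\<And>x y. nodes (c x y) \<le> nodes x + nodes y + 3"
  shows "poly_computable D i (\<lambda>a. c (f a) (g a))"
proof -
  have "poly_bounded D i (\<lambda>a. nodes (f a) + nodes (g a) + 3)"
    by (intro poly_bounded_intros poly_computable_nodes f g)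
  then have "poly_bounded D i (\<lambda>a. nodes (c (f a) (g a)))"
    by (rule poly_bounded_mono) (use size in auto)
  moreover have "\<exists>p \<tau>. poly_bounded D i \<tau> \<and> computes_at n p D i (\<lambda>a. c (f a) (g a)) \<tau>" for n
  proof -
    obtain p \<tau> where p: "poly_bounded D i \<tau>" "computes_at (n + 1) p D i f \<tau>"
      using f unfolding poly_computable_def by blast
    obtain q \<rho> where q: "poly_bounded D i \<rho>" "computes_at (n + 2) q D i g \<rho>"
      using g unfolding poly_computable_def by blast
    let ?\<sigma> = "\<lambda>a. nodes (i a) + (\<tau> a + (nodes (i a) + (\<rho> a + (2 * (nodes (f a) + nodes (g a)) + 3))))"
    have "poly_bounded D i ?\<sigma>"
      by (intro poly_bounded_intros poly_computable_nodes f g p q)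
    moreover have "computes_at n (Seq (Assign (n + 1) (Var n)) (Seq p
        (Seq (Assign (n + 2) (Var n)) (Seq q (Assign n (E (n + 1) (n + 2))))))) D i
        (\<lambda>a. c (f a) (g a)) ?\<sigma>"
      unfolding computes_at_def
    proof (intro allI ballI impI)
      fix s :: store and a assume a: "a \<in> D" and s: "s n = i a"
      define s1 where "s1 = s(n + 1 := i a)"
      have e1: "exec (Assign (n + 1) (Var n)) s (nodes (i a)) s1"
        using exec_Assign[of "n + 1" "Var n" s] s by (simp add: s1_def)
      obtain t2 s2 where e2: "exec p s1 t2 s2" and t2: "t2 \<le> \<tau> a" and s2: "s2 (n + 1) = f a"
          "\<And>m. m < n + 1 \<Longrightarrow> s2 m = s1 m"
        by (rule computes_atD[OF p(2) a, of s1]) (auto simp: s1_def)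
      define s3 where "s3 = s2(n + 2 := i a)"
      have "s2 n = i a" using s2(2)[of n] s by (simp add: s1_def)
      then have e3: "exec (Assign (n + 2) (Var n)) s2 (nodes (i a)) s3"
        using exec_Assign[of "n + 2" "Var n" s2] by (simp add: s3_def)
      obtain t4 s4 where e4: "exec q s3 t4 s4" and t4: "t4 \<le> \<rho> a" and s4: "s4 (n + 2) = g a"
          "\<And>m. m < n + 2 \<Longrightarrow> s4 m = s3 m"
        by (rule computes_atD[OF q(2) a, of s3]) (auto simp: s3_def)
      have s4': "s4 (n + 1) = f a" using s4(2)[of "n + 1"] s2 by (simp add: s3_def)
      let ?e = "E (n + 1) (n + 2)"
      have e5: "exec (Assign n ?e) s4 (eval_cost ?e s4) (s4(n := eval ?e s4))"
        by (rule exec_Assign)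
      have "eval_cost ?e s4 \<le> 2 * (nodes (f a) + nodes (g a)) + 3"
        using cost[of "n + 1" "n + 2" s4] s4 s4' by simp
      with t2 t4 have "nodes (i a) + (t2 + (nodes (i a) + (t4 + eval_cost ?e s4))) \<le> ?\<sigma> a"
        by linarith
      moreover have "(s4(n := eval ?e s4)) n = c (f a) (g a)"
        using ev s4 s4' by simp
      moreover have "\<forall>m<n. (s4(n := eval ?e s4)) m = s m"
        using s4 s2 by (simp add: s3_def s1_def)
      ultimately show "\<exists>t s'. exec (Seq (Assign (n + 1) (Var n)) (Seq p
        (Seq (Assign (n + 2) (Var n)) (Seq q (Assign n (E (n + 1) (n + 2))))))) s t s' \<and> t \<le> ?\<sigma> a \<and>
          s' n = c (f a) (g a) \<and> (\<forall>m<n. s' m = s m)"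
        using exec_Seq[OF e1 exec_Seq[OF e2 exec_Seq[OF e3 exec_Seq[OF e4 e5]]]] by blast
    qed
    ultimately show ?thesis by blast
  qed
  ultimately show ?thesis by (simp add: poly_computable_def)
qed

lemma poly_computable_Node:
  assumes "poly_computable D i f" "poly_computable D i g"
  shows "poly_computable D i (\<lambda>a. Node (f a) (g a))"
  by (rule poly_computable_expr[OF assms, where E = "\<lambda>u v. Cons_expr (Var u) (Var v)"]) auto

lemma nodes_left_le: "nodes (left t) \<le> nodes t" and nodes_right_le: "nodes (right t) \<le> nodes t"
  by (cases t; simp)+

lemma poly_computable_left:
  assumes "poly_computable D i f"
  shows "poly_computable D i (\<lambda>a. left (f a))"
proof (rule poly_computable_expr[OF assms assms, where E = "\<lambda>u v. Hd (Var u)" and c = "\<lambda>x y. left x"])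
  show "eval_cost (Hd (Var u)) s \<le> 2 * (nodes (s u) + nodes (s v)) + 3" for u v s
    using nodes_left_le[of "s u"] by simp
  show "nodes (left x) \<le> nodes x + nodes y + 3" for x y
    using nodes_left_le[of x] by simp
qed auto

lemma poly_computable_right:
  assumes "poly_computable D i f"
  shows "poly_computable D i (\<lambda>a. right (f a))"
proof (rule poly_computable_expr[OF assms assms, where E = "\<lambda>u v. Tl (Var u)" and c = "\<lambda>x y. right x"])
  show "eval_cost (Tl (Var u)) s \<le> 2 * (nodes (s u) + nodes (s v)) + 3" for u v s
    using nodes_right_le[of "s u"] by simp
  show "nodes (right x) \<le> nodes x + nodes y + 3" for x y
    using nodes_right_le[of x] by simp
qed auto

lemma poly_computable_const: "poly_computable D i (\<lambda>_. t)"
proof (induction t)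
  case Leaf
  show ?case
    by (rule poly_computable_expr[OF poly_computable_input poly_computable_input,
          where E = "\<lambda>u v. Nil_expr" and c = "\<lambda>x y. Leaf"]) auto
next
  case (Node l r)
  then show ?case by (rule poly_computable_Node)
qed

definition enc_bool :: "bool \<Rightarrow> tree" where
  "enc_bool b = (if b then Node Leaf Leaf else Leaf)"

lemma enc_bool_simps [simp]: "enc_bool True = Node Leaf Leaf" "enc_bool False = Leaf"
  by (auto simp: enc_bool_def)

lemma enc_bool_eq_Leaf [simp]: "enc_bool b = Leaf \<longleftrightarrow> \<not> b"
  by (simp add: enc_bool_def)

lemma poly_computable_eq:
  assumes "poly_computable D i f" "poly_computable D i g"
  shows "poly_computable D i (\<lambda>a. enc_bool (f a = g a))"
  by (rule poly_computable_expr[OF assms, where E = "\<lambda>u v. Equal (Var u) (Var v)"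
        and c = "\<lambda>x y. enc_bool (x = y)"]) (auto simp: enc_bool_def)

text \<open>Each branch only has to work on the inputs that reach it, so a function can be assembled
  from programs that presuppose a particular constructor.\<close>

lemma poly_computable_If_restricted:
  assumes P: "poly_computable D i (\<lambda>a. enc_bool (P a))"
    and f: "poly_computable {a \<in> D. P a} i f"
    and g: "poly_computable {a \<in> D. \<not> P a} i g"
  shows "poly_computable D i (\<lambda>a. if P a then f a else g a)"
proof -
  have bounded_If: "poly_bounded D i (\<lambda>a. if P a then u a else v a)"
    if u: "poly_bounded {a \<in> D. P a} i u" and v: "poly_bounded {a \<in> D. \<not> P a} i v" for u v
  proof -
    from u obtain k where k: "\<And>a. a \<in> D \<Longrightarrow> P a \<Longrightarrow> u a \<le> Suc (nodes (i a)) ^ k"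
      by (auto simp: poly_bounded_def)
    from v obtain l where l: "\<And>a. a \<in> D \<Longrightarrow> \<not> P a \<Longrightarrow> v a \<le> Suc (nodes (i a)) ^ l"
      by (auto simp: poly_bounded_def)
    have max: "Suc (nodes (i a)) ^ m \<le> Suc (nodes (i a)) ^ max k l" if "m \<in> {k, l}" for a m
      using that by (intro power_increasing) auto
    have "\<forall>a\<in>D. (if P a then u a else v a) \<le> Suc (nodes (i a)) ^ max k l"
      using le_trans[OF k max] le_trans[OF l max] by simp
    then show ?thesis unfolding poly_bounded_def ..
  qed
  have "poly_bounded D i (\<lambda>a. if P a then nodes (f a) else nodes (g a))"
    by (intro bounded_If poly_computable_nodes f g)
  then have "poly_bounded D i (\<lambda>a. nodes (if P a then f a else g a))"
    by (rule poly_bounded_mono) auto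
  moreover have "\<exists>p \<tau>. poly_bounded D i \<tau> \<and> computes_at n p D i (\<lambda>a. if P a then f a else g a) \<tau>" for n
  proof -
    obtain p \<tau> where p: "poly_bounded D i \<tau>" "computes_at (n + 1) p D i (\<lambda>a. enc_bool (P a)) \<tau>"
      using P unfolding poly_computable_def by blast
    obtain q \<rho> where q: "poly_bounded {a \<in> D. P a} i \<rho>" "computes_at n q {a \<in> D. P a} i f \<rho>"
      using f unfolding poly_computable_def by blast
    obtain r \<upsilon> where r: "poly_bounded {a \<in> D. \<not> P a} i \<upsilon>" "computes_at n r {a \<in> D. \<not> P a} i g \<upsilon>"
      using g unfolding poly_computable_def by blast
    let ?\<sigma> = "\<lambda>a. nodes (i a) + (\<tau> a + (3 + (if P a then \<rho> a else \<upsilon> a)))"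
    have "poly_bounded D i ?\<sigma>"
      by (intro poly_bounded_intros bounded_If p q r)
    moreover have "computes_at n (Seq (Assign (n + 1) (Var n)) (Seq p (If (Var (n + 1)) q r))) D i
        (\<lambda>a. if P a then f a else g a) ?\<sigma>"
      unfolding computes_at_def
    proof (intro allI ballI impI)
      fix s :: store and a assume a: "a \<in> D" and s: "s n = i a"
      define s1 where "s1 = s(n + 1 := i a)"
      have e1: "exec (Assign (n + 1) (Var n)) s (nodes (i a)) s1"
        using exec_Assign[of "n + 1" "Var n" s] s by (simp add: s1_def)
      obtain t2 s2 where e2: "exec p s1 t2 s2" and t2: "t2 \<le> \<tau> a" and s2: "s2 (n + 1) = enc_bool (P a)"
          "\<And>m. m < n + 1 \<Longrightarrow> s2 m = s1 m"
        by (rule computes_atD[OF p(2) a, of s1]) (auto simp: s1_def)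
      have s2n: "s2 n = i a" using s2(2)[of n] s by (simp add: s1_def)
      have c: "eval_cost (Var (n + 1)) s2 \<le> 3"
        by (simp add: s2(1)[simplified] enc_bool_def)
      have "\<exists>t s'. exec (If (Var (n + 1)) q r) s2 t s' \<and> t \<le> 3 + (if P a then \<rho> a else \<upsilon> a) \<and>
          s' n = (if P a then f a else g a) \<and> (\<forall>m<n. s' m = s2 m)"
      proof (cases "P a")
        case True
        then obtain t s' where e: "exec q s2 t s'" and "t \<le> \<rho> a" "s' n = f a" "\<And>m. m < n \<Longrightarrow> s' m = s2 m"
          using computes_atD[OF q(2), of a s2] a s2n by auto
        moreover have "exec (If (Var (n + 1)) q r) s2 (eval_cost (Var (n + 1)) s2 + t) s'"
          by (rule exec_If_true[OF _ e]) (use s2 True in simp)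
        ultimately show ?thesis using True c
          by (intro exI conjI) (assumption | simp)+
      next
        case False
        then obtain t s' where e: "exec r s2 t s'" and "t \<le> \<upsilon> a" "s' n = g a" "\<And>m. m < n \<Longrightarrow> s' m = s2 m"
          using computes_atD[OF r(2), of a s2] a s2n by auto
        moreover have "exec (If (Var (n + 1)) q r) s2 (eval_cost (Var (n + 1)) s2 + t) s'"
          by (rule exec_If_false[OF _ e]) (use s2 False in simp)
        ultimately show ?thesis using False c
          by (intro exI conjI) (assumption | simp)+
      qed
      then obtain t s' where e3: "exec (If (Var (n + 1)) q r) s2 t s'"
        and t: "t \<le> 3 + (if P a then \<rho> a else \<upsilon> a)"
        and s': "s' n = (if P a then f a else g a)" "\<And>m. m < n \<Longrightarrow> s' m = s2 m" by blast
      have "nodes (i a) + (t2 + t) \<le> ?\<sigma> a" using t t2 by linarith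
      moreover have "\<forall>m<n. s' m = s m" using s' s2 by (simp add: s1_def)
      ultimately show "\<exists>t s'. exec (Seq (Assign (n + 1) (Var n)) (Seq p (If (Var (n + 1)) q r))) s t s' \<and>
          t \<le> ?\<sigma> a \<and> s' n = (if P a then f a else g a) \<and> (\<forall>m<n. s' m = s m)"
        using exec_Seq[OF e1 exec_Seq[OF e2 e3]] s'(1) by blast
    qed
    ultimately show ?thesis by blast
  qed
  ultimately show ?thesis by (simp add: poly_computable_def)
qed

lemma poly_computable_If:
  assumes "poly_computable D i (\<lambda>a. enc_bool (P a))" "poly_computable D i f" "poly_computable D i g"
  shows "poly_computable D i (\<lambda>a. if P a then f a else g a)"
  by (rule poly_computable_If_restricted[OF assms(1) poly_computable_subset[OF assms(2)]
        poly_computable_subset[OF assms(3)]]) auto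

lemma poly_computable_comp:
  assumes h: "poly_computable D i (\<lambda>a. j (h a))" and g: "poly_computable D' j g"
    and D': "\<And>a. a \<in> D \<Longrightarrow> h a \<in> D'"
  shows "poly_computable D i (\<lambda>a. g (h a))"
proof -
  have nodes: "poly_bounded D i (\<lambda>a. nodes (j (h a)))" by (rule poly_computable_nodes[OF h])
  have "poly_bounded D i (\<lambda>a. nodes (g (h a)))"
    by (rule poly_bounded_comp[OF poly_computable_nodes[OF g] nodes D'])
  moreover have "\<exists>p \<tau>. poly_bounded D i \<tau> \<and> computes_at n p D i (\<lambda>a. g (h a)) \<tau>" for n
  proof -
    obtain p \<tau> where p: "poly_bounded D i \<tau>" "computes_at n p D i (\<lambda>a. j (h a)) \<tau>"
      using h unfolding poly_computable_def by blast
    obtain q \<rho> where q: "poly_bounded D' j \<rho>" "computes_at n q D' j g \<rho>"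
      using g unfolding poly_computable_def by blast
    have "poly_bounded D i (\<lambda>a. \<tau> a + \<rho> (h a))"
      by (intro poly_bounded_intros p poly_bounded_comp[OF q(1) nodes D'])
    moreover have "computes_at n (Seq p q) D i (\<lambda>a. g (h a)) (\<lambda>a. \<tau> a + \<rho> (h a))"
      unfolding computes_at_def
    proof (intro allI ballI impI)
      fix s :: store and a assume a: "a \<in> D" and s: "s n = i a"
      obtain t1 s1 where 1: "exec p s t1 s1" "t1 \<le> \<tau> a" "s1 n = j (h a)" "\<And>m. m < n \<Longrightarrow> s1 m = s m"
        by (rule computes_atD[where s = s, OF p(2) a s]) auto
      obtain t2 s2 where 2: "exec q s1 t2 s2" "t2 \<le> \<rho> (h a)" "s2 n = g (h a)" "\<And>m. m < n \<Longrightarrow> s2 m = s1 m"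
        by (rule computes_atD[where s = s1, OF q(2) D'[OF a] 1(3)]) auto
      from 1 2 show "\<exists>t s'. exec (Seq p q) s t s' \<and> t \<le> \<tau> a + \<rho> (h a) \<and> s' n = g (h a) \<and>
          (\<forall>m<n. s' m = s m)"
        using exec_Seq[OF 1(1) 2(1)] by (intro exI conjI) (assumption | simp)+
    qed
    ultimately show ?thesis by blast
  qed
  ultimately show ?thesis by (simp add: poly_computable_def)
qed

text \<open>A sequence of loop iterations, each entered with a true guard, the head of the encoded
  state. \<open>S\<close> bounds every state from which an iteration starts; guard and body are paid
  for in terms of it.\<close>

inductive runs :: "('b \<Rightarrow> 'b) \<Rightarrow> ('b \<Rightarrow> tree) \<Rightarrow> 'b set \<Rightarrow> nat \<Rightarrow> nat \<Rightarrow> 'b \<Rightarrow> 'b \<Rightarrow> bool"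
  for \<sigma> j D S where
  runs_refl: "runs \<sigma> j D S 0 b b"
| runs_step: "b \<in> D \<Longrightarrow> left (j b) \<noteq> Leaf \<Longrightarrow> nodes (j b) \<le> S \<Longrightarrow> runs \<sigma> j D S m (\<sigma> b) b' \<Longrightarrow>
    runs \<sigma> j D S (Suc m) b b'"

lemma runs_trans: "runs \<sigma> j D S m b b' \<Longrightarrow> runs \<sigma> j D S m' b' b'' \<Longrightarrow> runs \<sigma> j D S (m + m') b b''"
  by (induction rule: runs.induct) (auto intro: runs.intros)

text \<open>Each of the \<open>N a\<close> iterations costs at most \<open>2 * S a\<close> for the
  guard and \<open>(S a + 1) ^ k\<close> for the body. The failing last test is paid for by the size
  of the final state.\<close>

lemma poly_computable_loop:
  assumes init: "poly_computable D i (\<lambda>a. j (h a))"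
    and step: "poly_computable D' j (\<lambda>b. j (\<sigma> b))"
    and N: "poly_bounded D i N" and S: "poly_bounded D i S"
    and runs: "\<And>a. a \<in> D \<Longrightarrow> runs \<sigma> j D' (S a) (N a) (h a) (r a)"
    and final: "\<And>a. a \<in> D \<Longrightarrow> left (j (r a)) = Leaf"
    and size: "poly_bounded D i (\<lambda>a. nodes (j (r a)))"
  shows "poly_computable D i (\<lambda>a. j (r a))"
proof -
  have "\<exists>p \<tau>. poly_bounded D i \<tau> \<and> computes_at n p D i (\<lambda>a. j (r a)) \<tau>" for n
  proof -
    obtain p \<tau> where p: "poly_bounded D i \<tau>" "computes_at n p D i (\<lambda>a. j (h a)) \<tau>"
      using init unfolding poly_computable_def by blast
    obtain q \<rho> where q: "poly_bounded D' j \<rho>" "computes_at n q D' j (\<lambda>b. j (\<sigma> b)) \<rho>"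
      using step unfolding poly_computable_def by blast
    obtain k where k: "\<And>b. b \<in> D' \<Longrightarrow> \<rho> b \<le> Suc (nodes (j b)) ^ k"
      using poly_boundedE[OF q(1)] by metis
    have loop: "\<exists>t s'. exec (While (Hd (Var n)) q) s t s' \<and>
        t \<le> m * (2 * S + (S + 1) ^ k) + 2 * nodes (j b') \<and> s' n = j b' \<and> (\<forall>m<n. s' m = s m)"
      if "runs \<sigma> j D' S m b b'" "left (j b') = Leaf" "s n = j b" for S m b b' s
      using that
    proof (induction arbitrary: s rule: runs.induct)
      case (runs_refl b)
      have "exec (While (Hd (Var n)) q) s (eval_cost (Hd (Var n)) s) s"
        by (rule exec_While_false) (use runs_refl in simp)
      moreover have "eval_cost (Hd (Var n)) s \<le> 2 * nodes (j b)"
        using nodes_left_le[of "j b"] runs_refl by simp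
      ultimately show ?case using runs_refl(2) by (intro exI conjI) (assumption | simp)+
    next
      case (runs_step b m b')
      obtain t1 s1 where 1: "exec q s t1 s1" "t1 \<le> \<rho> b" "s1 n = j (\<sigma> b)" "\<And>m. m < n \<Longrightarrow> s1 m = s m"
        by (rule computes_atD[where s = s, OF q(2) runs_step.hyps(1) runs_step.prems(2)]) auto
      obtain t2 s2 where 2: "exec (While (Hd (Var n)) q) s1 t2 s2"
        "t2 \<le> m * (2 * S + (S + 1) ^ k) + 2 * nodes (j b')" "s2 n = j b'" "\<And>m. m < n \<Longrightarrow> s2 m = s1 m"
        using runs_step.IH runs_step.prems(1) 1(3) by blast
      have "exec (While (Hd (Var n)) q) s (eval_cost (Hd (Var n)) s + t1 + t2) s2"
        by (rule exec_While_true[OF _ 1(1) 2(1)]) (use runs_step in simp)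
      moreover have "eval_cost (Hd (Var n)) s \<le> 2 * S"
        using nodes_left_le[of "j b"] runs_step by simp
      moreover have "t1 \<le> (S + 1) ^ k"
      proof -
        have "t1 \<le> Suc (nodes (j b)) ^ k" using 1(2) k[OF runs_step.hyps(1)] by simp
        also have "\<dots> \<le> (S + 1) ^ k" using runs_step.hyps by (intro power_mono) auto
        finally show ?thesis .
      qed
      ultimately have "exec (While (Hd (Var n)) q) s (eval_cost (Hd (Var n)) s + t1 + t2) s2 \<and>
        eval_cost (Hd (Var n)) s + t1 + t2 \<le> Suc m * (2 * S + (S + 1) ^ k) + 2 * nodes (j b')"
        using 2(2) by simp
      moreover have "\<forall>m<n. s2 m = s m" using 1(4) 2(4) by simp
      ultimately show ?case using 2(3) by blast
    qed
    let ?\<tau> = "\<lambda>a. \<tau> a + (N a * (2 * S a + (S a + 1) ^ k) + 2 * nodes (j (r a)))"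
    have "poly_bounded D i ?\<tau>"
      by (intro poly_bounded_intros poly_bounded_power p N S size)
    moreover have "computes_at n (Seq p (While (Hd (Var n)) q)) D i (\<lambda>a. j (r a)) ?\<tau>"
      unfolding computes_at_def
    proof (intro allI ballI impI)
      fix s :: store and a assume a: "a \<in> D" and s: "s n = i a"
      obtain t1 s1 where 1: "exec p s t1 s1" "t1 \<le> \<tau> a" "s1 n = j (h a)" "\<And>m. m < n \<Longrightarrow> s1 m = s m"
        by (rule computes_atD[where s = s, OF p(2) a s]) auto
      obtain t2 s2 where 2: "exec (While (Hd (Var n)) q) s1 t2 s2"
        "t2 \<le> N a * (2 * S a + (S a + 1) ^ k) + 2 * nodes (j (r a))"
        "s2 n = j (r a)" "\<And>m. m < n \<Longrightarrow> s2 m = s1 m"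
        using loop[where s = s1, OF runs[OF a] final[OF a] 1(3)] by blast
      from 1 2 show "\<exists>t s'. exec (Seq p (While (Hd (Var n)) q)) s t s' \<and> t \<le> ?\<tau> a \<and>
          s' n = j (r a) \<and> (\<forall>m<n. s' m = s m)"
        using exec_Seq[OF 1(1) 2(1)] by (intro exI conjI) (assumption | simp)+
    qed
    ultimately show ?thesis by blast
  qed
  with size show ?thesis by (simp add: poly_computable_def)
qed

text \<open>Since \<open>Suc m \<le> 2 * m\<close> for positive \<open>m\<close>, a bound
  \<open>Suc m ^ k\<close> becomes \<open>2 ^ k * m ^ k\<close>. Offset 0 matches the input and
  output convention of \<open>runs_to\<close>.\<close>

lemma poly_computable_imp_computes:
  assumes "poly_computable D enc (\<lambda>a. enc (f a))"
  obtains p where "computes_in_poly_time enc D p f"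
proof -
  obtain p \<tau> where p: "computes_at 0 p D enc (\<lambda>a. enc (f a)) \<tau>" and \<tau>: "poly_bounded D enc \<tau>"
    using assms unfolding poly_computable_def by blast
  obtain k where k: "\<And>a. a \<in> D \<Longrightarrow> \<tau> a \<le> Suc (nodes (enc a)) ^ k"
    using poly_boundedE[OF \<tau>] by metis
  have "\<exists>t. runs_to p (enc x) t (enc (f x)) \<and> t \<le> 2 ^ k * nodes (enc x) ^ k + 2 ^ k" if x: "x \<in> D" for x
  proof -
    obtain t s' where t: "exec p ((\<lambda>_. Leaf)(0 := enc x)) t s'" "t \<le> \<tau> x" "s' 0 = enc (f x)"
      by (rule computes_atD[where s = "(\<lambda>_. Leaf)(0 := enc x)", OF p x]) auto
    have "\<tau> x \<le> Suc (nodes (enc x)) ^ k" by (rule k[OF x])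
    also have "\<dots> \<le> (2 * nodes (enc x)) ^ k"
      using nodes_pos[of "enc x"] by (intro power_mono) linarith+
    finally have "t \<le> 2 ^ k * nodes (enc x) ^ k + 2 ^ k"
      using t(2) by (simp add: power_mult_distrib)
    then show ?thesis using t unfolding runs_to_def by blast
  qed
  then have "computes_in_poly_time enc D p f"
    unfolding computes_in_poly_time_def by blast
  then show ?thesis by (rule that)
qed

section \<open>Termination\<close>

primrec weight :: "fo \<Rightarrow> nat" where
  "weight (Atom R xs) = 2"
| "weight (Neg F) = weight F"
| "weight (Bin b F G) = weight F + weight G + 1"
| "weight (Qu q x F) = weight F * weight F"

lemma weight_ge: "2 \<le> weight F"
proof (induction F)
  case (Qu q x F)
  then have "2 * 1 \<le> weight F * weight F" by (intro mult_mono) auto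
  then show ?case by simp
qed auto

lemma weight_ACO_step: "rule_step r F G \<Longrightarrow> r \<in> ACO \<Longrightarrow> weight F = weight G"
  by (induction rule: rule_step.induct) (auto simp: ACO_def elim!: root_step.cases)

lemma weight_conv: "(F, G) \<in> conv ACO \<Longrightarrow> weight F = weight G"
  unfolding conv_def
  by (induction rule: rtrancl_induct) (auto simp: rewr_def dest: weight_ACO_step)

text \<open>The weight is strictly monotone in every argument, so only root steps matter. For
  \<open>rule_Pdown\<close> the gain is that the side without the variable contributes
  \<open>b\<close> instead of its square.\<close>

lemma weight_step: "rule_step r F G \<Longrightarrow> r \<in> {rule_Pdown, rule_Sdown, rule_M} \<Longrightarrow> weight G < weight F"
proof (induction rule: rule_step.induct)
  case (root F G)
  have sq: "m < m * m" if "2 \<le> m" for m :: nat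
    using that by (metis Suc_1 Suc_le_lessD less_le_trans mult.right_neutral mult_less_cancel1 zero_less_Suc)
  from root show ?case
  proof (cases rule: root_step.cases)
    case (M x q)
    then show ?thesis using sq[OF weight_ge] by simp
  next
    case (P_Ex x F2 F1)
    then show ?thesis using weight_ge[of F1] weight_ge[of F2] sq[OF weight_ge, of F2]
      by (simp add: algebra_simps)
  next
    case (P_All x F2 F1)
    then show ?thesis using weight_ge[of F1] weight_ge[of F2] sq[OF weight_ge, of F2]
      by (simp add: algebra_simps)
  next
    case (S_Ex x F1 F2)
    then show ?thesis using weight_ge[of F1] weight_ge[of F2] by (simp add: algebra_simps)
  next
    case (S_All x F1 F2)
    then show ?thesis using weight_ge[of F1] weight_ge[of F2] by (simp add: algebra_simps)
  qed auto
qed (auto intro: mult_strict_mono')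

lemma snd_system_Y_iff:
  "(C, C') \<in> snd system_Y \<longleftrightarrow> C \<in> PFO // conv ACO \<and> C' \<in> PFO // conv ACO \<and>
     (\<exists>F\<in>C. \<exists>G\<in>C'. F \<in> PFO \<and> G \<in> PFO \<and> (F, G) \<in> rewr {rule_Pdown, rule_Sdown, rule_M})"
  by (auto simp: system_Y_def quotient_system_def)

lemma terminating_Y: "terminating system_Y"
proof -
  \<comment> \<open>The choice of representative is immaterial, because \<open>weight\<close> is
    constant on classes.\<close>
  define \<mu> where "\<mu> C = weight (SOME F. F \<in> C)" for C
  have \<mu>: "\<mu> C = weight F" if C: "C \<in> PFO // conv ACO" "F \<in> C" for C F
  proof -
    have "(SOME F. F \<in> C) \<in> C" using C(2) by (rule someI)
    with C obtain H where "(H, SOME F. F \<in> C) \<in> conv ACO" "(H, F) \<in> conv ACO"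
      by (auto elim!: quotientE)
    then show ?thesis unfolding \<mu>_def by (metis weight_conv)
  qed
  have "\<mu> C' < \<mu> C" if "(C, C') \<in> snd system_Y" for C C'
    using that by (auto simp: snd_system_Y_iff \<mu> rewr_def dest: weight_step)
  then have "snd system_Y \<subseteq> (measure \<mu>)\<inverse>" by auto
  then have "wf ((snd system_Y)\<inverse>)"
    by (metis converse_mono converse_converse wf_measure wf_subset)
  then show ?thesis
    unfolding terminating_def wf_iff_no_infinite_down_chain by blast
qed

section \<open>Normal forms\<close>

text \<open>All six rules at once: steps of \<open>ACO\<close> become equalities in the quotient, so
  a derivation may reorder freely between proper steps.\<close>

abbreviation rewrites_to :: "fo \<Rightarrow> fo \<Rightarrow> bool" (infix "\<leadsto>" 50) where
  "F \<leadsto> G \<equiv> (F, G) \<in> (rewr UNIV)\<^sup>*"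

lemma rewrites_root: "root_step r F G \<Longrightarrow> F \<leadsto> G"
  by (auto simp: rewr_def intro: rule_step.root)

lemma rewrites_context:
  assumes "F \<leadsto> G" and "\<And>r F G. rule_step r F G \<Longrightarrow> rule_step r (K F) (K G)"
  shows "K F \<leadsto> K G"
  using assms(1)
proof (induction rule: rtrancl_induct)
  case (step G H)
  then have "(K G, K H) \<in> rewr UNIV" using assms(2) by (auto simp: rewr_def)
  with step show ?case by simp
qed simp

lemma rewrites_Qu: "F \<leadsto> G \<Longrightarrow> Qu q x F \<leadsto> Qu q x G"
  by (rule rewrites_context[where K = "Qu q x"]) (auto intro: rule_step.in_Qu)

lemma rewrites_Bin: "F \<leadsto> F' \<Longrightarrow> G \<leadsto> G' \<Longrightarrow> Bin b F G \<leadsto> Bin b F' G'"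
  using rewrites_context[of F F' "\<lambda>H. Bin b H G"] rewrites_context[of G G' "Bin b F'"]
  by (meson rtrancl_trans rule_step.in_Bin_left rule_step.in_Bin_right)

lemma rewrites_imp_system_Y:
  assumes "F \<leadsto> G" "F \<in> PFO"
  shows "G \<in> PFO \<and> (conv_class ACO F, conv_class ACO G) \<in> (snd system_Y)\<^sup>*"
  using assms(1)
proof (induction rule: rtrancl_induct)
  case (step G H)
  then obtain r where r: "rule_step r G H" by (auto simp: rewr_def)
  then have H: "H \<in> PFO" using step rule_step_pfo by (auto simp: PFO_def)
  show ?case
  proof (cases "r \<in> ACO")
    case True
    then have "(G, H) \<in> conv ACO" using r by (auto simp: conv_def rewr_def)
    then have "conv_class ACO G = conv_class ACO H"
      unfolding conv_class_def by (rule equiv_class_eq[OF equiv_conv])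
    with step H show ?thesis by simp
  next
    case False
    then have "r \<in> {rule_Pdown, rule_Sdown, rule_M}" by (cases r) (auto simp: ACO_def)
    then have "(G, H) \<in> rewr {rule_Pdown, rule_Sdown, rule_M}" using r by (auto simp: rewr_def)
    moreover have "(F', F') \<in> conv ACO" for F' by (simp add: conv_def)
    ultimately have "(conv_class ACO G, conv_class ACO H) \<in> snd system_Y"
      using step H unfolding snd_system_Y_iff conv_class_def
      by (auto intro: quotientI)
    with step H show ?thesis by auto
  qed
qed (use assms(2) in simp)

text \<open>The binary connective on which \<open>rule_Pdown\<close> acts for the given quantifier.\<close>

fun conn :: "quant \<Rightarrow> binop" where
  "conn Ex = Conj"
| "conn All = Disj"

text \<open>\<open>x\<close> is free in every \<open>b\<close>-component, a component being a leaf
  of the tree of \<open>b\<close>-connectives at the top. If some component lacks \<open>x\<close>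
  and there are at least two, reordering brings it into the position required by
  \<open>rule_Pdown\<close>.\<close>

primrec free_in_all :: "binop \<Rightarrow> nat \<Rightarrow> fo \<Rightarrow> bool" where
  "free_in_all b x (Atom R xs) \<longleftrightarrow> x \<in> set xs"
| "free_in_all b x (Neg F) \<longleftrightarrow> x \<in> free F"
| "free_in_all b x (Bin c F G) \<longleftrightarrow>
     (if c = b then free_in_all b x F \<and> free_in_all b x G else x \<in> free F \<union> free G)"
| "free_in_all b x (Qu q y F) \<longleftrightarrow> x \<in> free F - {y}"

text \<open>Modulo \<open>ACO\<close>, neither \<open>rule_Pdown\<close> nor \<open>rule_Sdown\<close> moves \<open>Qu q x\<close> into \<open>F\<close>.\<close>

primrec stuck :: "quant \<Rightarrow> nat \<Rightarrow> fo \<Rightarrow> bool" where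
  "stuck q x (Atom R xs) \<longleftrightarrow> True"
| "stuck q x (Neg F) \<longleftrightarrow> True"
| "stuck q x (Bin b F G) \<longleftrightarrow> b = conn q \<and> free_in_all b x F \<and> free_in_all b x G"
| "stuck q x (Qu q' y F) \<longleftrightarrow> (q' = q \<longrightarrow> stuck q x F)"

text \<open>In the last clause, \<open>x \<in> free F\<close> rules out \<open>rule_M\<close>, and
  \<open>stuck\<close> rules out \<open>rule_Pdown\<close> and \<open>rule_Sdown\<close>.\<close>

primrec normal :: "fo \<Rightarrow> bool" where
  "normal (Atom R xs) \<longleftrightarrow> True"
| "normal (Neg F) \<longleftrightarrow> normal F"
| "normal (Bin b F G) \<longleftrightarrow> normal F \<and> normal G"
| "normal (Qu q x F) \<longleftrightarrow> normal F \<and> x \<in> free F \<and> stuck q x F"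

lemma free_in_all_imp_free: "free_in_all b x F \<Longrightarrow> x \<in> free F"
  by (induction F) (auto split: if_splits)

lemma free_ACO_step: "rule_step r F G \<Longrightarrow> r \<in> ACO \<Longrightarrow> free F = free G"
  by (induction rule: rule_step.induct) (auto simp: ACO_def elim!: root_step.cases)

lemma free_in_all_ACO_step:
  "rule_step r F G \<Longrightarrow> r \<in> ACO \<Longrightarrow> free_in_all b x F = free_in_all b x G"
proof (induction rule: rule_step.induct)
  case (root F G)
  then show ?case by (cases rule: root_step.cases) (auto simp: ACO_def)
qed (simp_all add: free_ACO_step)

text \<open>\<open>rule_A\<close> and \<open>rule_C\<close> only rearrange components, and
  \<open>stuck\<close> looks through like quantifiers, so their order under \<open>rule_O\<close> is
  invisible to it.\<close>

lemma stuck_ACO_step: "rule_step r F G \<Longrightarrow> r \<in> ACO \<Longrightarrow> stuck q x F = stuck q x G"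
proof (induction rule: rule_step.induct)
  case (root F G)
  then show ?case by (cases rule: root_step.cases) (auto simp: ACO_def)
qed (simp_all add: free_in_all_ACO_step)

lemma normal_ACO_step: "rule_step r F G \<Longrightarrow> r \<in> ACO \<Longrightarrow> normal F = normal G"
proof (induction rule: rule_step.induct)
  case (root F G)
  then show ?case by (cases rule: root_step.cases) (auto simp: ACO_def)
qed (simp_all add: free_ACO_step stuck_ACO_step)

lemma normal_conv: "(F, G) \<in> conv ACO \<Longrightarrow> normal F = normal G"
  unfolding conv_def
  by (induction rule: rtrancl_induct) (auto simp: rewr_def dest: normal_ACO_step)

lemma normal_no_step: "rule_step r F G \<Longrightarrow> r \<in> {rule_Pdown, rule_Sdown, rule_M} \<Longrightarrow> \<not> normal F"
proof (induction rule: rule_step.induct)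
  case (root F G)
  then show ?case
    by (cases rule: root_step.cases) (auto dest: free_in_all_imp_free)
qed auto

text \<open>A step of the quotient starts at some member of the class; that member is again
  \<open>normal\<close> by \<open>normal_conv\<close>, which contradicts
  \<open>normal_no_step\<close>.\<close>

lemma normal_imp_no_system_Y_step: "normal F \<Longrightarrow> (conv_class ACO F, C) \<notin> snd system_Y"
  by (auto simp: snd_system_Y_iff conv_class_def rewr_def dest: normal_conv normal_no_step)

text \<open>If both sides contain \<open>x\<close>, the pushed forms \<open>P\<close> and
  \<open>P'\<close> are discarded and \<open>Qu q x\<close> stays in front of the joined components;
  if only one does, its pushed form survives. This is why \<open>A\<close> is remembered next to
  \<open>P\<close>.\<close>

definition merge_parts ::
    "quant \<Rightarrow> nat \<Rightarrow> (fo \<times> fo) option \<times> fo option \<Rightarrow> (fo \<times> fo) option \<times> fo option \<Rightarrow>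
      (fo \<times> fo) option \<times> fo option" where
  "merge_parts q x u v =
     (case (fst u, fst v) of
        (None, a) \<Rightarrow> a
      | (a, None) \<Rightarrow> a
      | (Some (A, P), Some (A', P')) \<Rightarrow> Some (Bin (conn q) A A', Qu q x (Bin (conn q) A A')),
      case (snd u, snd v) of
        (None, b) \<Rightarrow> b
      | (b, None) \<Rightarrow> b
      | (Some B, Some B') \<Rightarrow> Some (Bin (conn q) B B'))"

definition join_parts :: "quant \<Rightarrow> (fo \<times> fo) option \<times> fo option \<Rightarrow> fo" where
  "join_parts q u =
     (case u of
        (None, b) \<Rightarrow> the b
      | (Some (A, P), None) \<Rightarrow> P
      | (Some (A, P), Some B) \<Rightarrow> Bin (conn q) P B)"

definition single_part :: "nat \<Rightarrow> fo \<Rightarrow> fo \<Rightarrow> (fo \<times> fo) option \<times> fo option" where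
  "single_part x F P = (if x \<in> free F then (Some (F, P), None) else (None, Some F))"

text \<open>\<open>parts q x F\<close> separates the \<open>conn q\<close>-components of \<open>F\<close> with \<open>x\<close> free (joined in \<open>A\<close>) from the
  others (joined in \<open>B\<close>), as \<open>(Some (A, P), Some B)\<close> where \<open>P\<close> is what \<open>Qu q x A\<close> is rewritten to.\<close>

primrec parts :: "quant \<Rightarrow> nat \<Rightarrow> fo \<Rightarrow> (fo \<times> fo) option \<times> fo option" where
  "parts q x (Atom R xs) = single_part x (Atom R xs) (Qu q x (Atom R xs))"
| "parts q x (Neg F) = single_part x (Neg F) (Qu q x (Neg F))"
| "parts q x (Bin b F G) =
     (if b = conn q then merge_parts q x (parts q x F) (parts q x G)
      else single_part x (Bin b F G) (Bin b (join_parts q (parts q x F)) (join_parts q (parts q x G))))"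
| "parts q x (Qu q' y F) =
     single_part x (Qu q' y F)
       (if q' = q then Qu q' y (join_parts q (parts q x F)) else Qu q x (Qu q' y F))"

definition push :: "quant \<Rightarrow> nat \<Rightarrow> fo \<Rightarrow> fo" where
  "push q x F = join_parts q (parts q x F)"

primrec nf :: "fo \<Rightarrow> fo" where
  "nf (Atom R xs) = Atom R xs"
| "nf (Neg F) = Neg (nf F)"
| "nf (Bin b F G) = Bin b (nf F) (nf G)"
| "nf (Qu q x F) = push q x (nf F)"

section \<open>Rewriting sequences that regroup components and move a quantifier\<close>

lemma rewrites_Bin_left: "F \<leadsto> F' \<Longrightarrow> Bin b F G \<leadsto> Bin b F' G"
  by (simp add: rewrites_Bin)

lemma rewrites_Bin_right: "G \<leadsto> G' \<Longrightarrow> Bin b F G \<leadsto> Bin b F G'"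
  by (simp add: rewrites_Bin)

lemma rewrites_comm: "Bin b F G \<leadsto> Bin b G F"
  by (rule rewrites_root) (rule root_step.C)

lemma rewrites_assoc: "Bin b (Bin b F G) H \<leadsto> Bin b F (Bin b G H)"
  "Bin b F (Bin b G H) \<leadsto> Bin b (Bin b F G) H"
  by (rule rewrites_root, rule root_step.intros)+

lemma rewrites_left_comm: "Bin b F (Bin b G H) \<leadsto> Bin b G (Bin b F H)"
  by (meson rewrites_assoc rewrites_comm rewrites_Bin_left rtrancl_trans)

lemma rewrites_right_comm: "Bin b (Bin b F G) H \<leadsto> Bin b (Bin b F H) G"
  by (meson rewrites_assoc rewrites_comm rewrites_Bin_right rtrancl_trans)

lemma rewrites_interchange:
  "Bin b (Bin b F G) (Bin b F' G') \<leadsto> Bin b (Bin b F F') (Bin b G G')"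
  by (meson rewrites_assoc rewrites_left_comm rewrites_Bin_right rtrancl_trans)

lemma rewrites_distribute: "b \<noteq> conn q \<Longrightarrow> Qu q x (Bin b F G) \<leadsto> Bin b (Qu q x F) (Qu q x G)"
  by (cases q; cases b) (auto intro: rewrites_root root_step.intros)

lemma rewrites_pull:
  "x \<notin> free G \<Longrightarrow> Qu q x (Bin (conn q) F G) \<leadsto> Bin (conn q) (Qu q x F) G"
  by (cases q) (auto intro: rewrites_root root_step.intros)

lemma rewrites_swap: "Qu q x (Qu q y F) \<leadsto> Qu q y (Qu q x F)"
  by (rule rewrites_root) (rule root_step.O)

lemma rewrites_drop: "x \<notin> free F \<Longrightarrow> Qu q x F \<leadsto> F"
  by (rule rewrites_root) (rule root_step.M)

text \<open>The specification of \<open>parts\<close>. Freeness and rewriting are asserted for every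
  \<open>F\<close>, normality only for normal \<open>F\<close>. The last conditions, on other
  variables \<open>y\<close>, keep an enclosing \<open>Qu q y\<close> stuck after \<open>x\<close>
  has been pushed.\<close>

inductive splits :: "quant \<Rightarrow> nat \<Rightarrow> fo \<Rightarrow> (fo \<times> fo) option \<times> fo option \<Rightarrow> bool"
  for q x F where
  splits_none: "x \<notin> free F \<Longrightarrow> splits q x F (None, Some F)"
| splits_all:
    "x \<in> free F \<Longrightarrow> free P = free F - {x} \<Longrightarrow> Qu q x F \<leadsto> P \<Longrightarrow>
     (normal F \<Longrightarrow> free_in_all (conn q) x F \<and> normal P) \<Longrightarrow>
     (\<And>y. y \<noteq> x \<Longrightarrow> free_in_all (conn q) y F \<Longrightarrow> free_in_all (conn q) y P) \<Longrightarrow>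
     splits q x F (Some (F, P), None)"
| splits_some:
    "x \<in> free A \<Longrightarrow> x \<notin> free B \<Longrightarrow> free F = free A \<union> free B \<Longrightarrow> free P = free A - {x} \<Longrightarrow>
     F \<leadsto> Bin (conn q) A B \<Longrightarrow> Qu q x A \<leadsto> P \<Longrightarrow>
     (normal F \<Longrightarrow> free_in_all (conn q) x A \<and> normal A \<and> normal P \<and> normal B) \<Longrightarrow>
     (\<And>y. y \<noteq> x \<Longrightarrow> free_in_all (conn q) y F \<Longrightarrow>
        free_in_all (conn q) y A \<and> free_in_all (conn q) y P \<and> free_in_all (conn q) y B) \<Longrightarrow>
     splits q x F (Some (A, P), Some B)"

lemma splits_join:
  assumes "splits q x F u"
  shows "free (join_parts q u) = free F - {x}"
    and "Qu q x F \<leadsto> join_parts q u"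
    and "normal F \<Longrightarrow> normal (join_parts q u)"
proof -
  show "free (join_parts q u) = free F - {x}"
    using assms by (cases rule: splits.cases) (auto simp: join_parts_def)
  show "normal F \<Longrightarrow> normal (join_parts q u)"
    using assms by (cases rule: splits.cases) (auto simp: join_parts_def)
  show "Qu q x F \<leadsto> join_parts q u"
    using assms
  proof (cases rule: splits.cases)
    case splits_none
    then show ?thesis by (simp add: join_parts_def rewrites_drop)
  next
    case (splits_all P)
    then show ?thesis by (simp add: join_parts_def)
  next
    case (splits_some A B P)
    \<comment> \<open>\<open>B\<close> leaves the scope of \<open>Qu q x\<close> by
      \<open>rule_Pdown\<close>; then \<open>Qu q x A\<close> stands alone and becomes
      \<open>P\<close>.\<close>
    from splits_some(6) have "Qu q x F \<leadsto> Qu q x (Bin (conn q) A B)" by (rule rewrites_Qu)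
    also have "Qu q x (Bin (conn q) A B) \<leadsto> Bin (conn q) (Qu q x A) B"
      using splits_some(3) by (rule rewrites_pull)
    also have "Bin (conn q) (Qu q x A) B \<leadsto> Bin (conn q) P B"
      using splits_some(7) by (rule rewrites_Bin_left)
    finally show ?thesis using splits_some(1) by (simp add: join_parts_def)
  qed
qed

lemma splits_single:
  assumes "x \<in> free F \<Longrightarrow> free P = free F - {x} \<and> Qu q x F \<leadsto> P \<and> (normal F \<longrightarrow> normal P)"
    and "\<And>y. free_in_all (conn q) y F \<longleftrightarrow> y \<in> free F"
    and "\<And>y. x \<in> free F \<Longrightarrow> y \<noteq> x \<Longrightarrow> y \<in> free F \<Longrightarrow> free_in_all (conn q) y P"
  shows "splits q x F (single_part x F P)"
  using assms by (auto simp: single_part_def intro: splits_none splits_all)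

text \<open>Associativity and commutativity gather the components with \<open>x\<close> on the left
  and the others on the right. If both sides contribute to \<open>A\<close>, then \<open>x\<close>
  is free in all components of both contributions, which is what \<open>stuck\<close> demands of the
  quantifier left in front of them.\<close>

lemma splits_merge:
  assumes "splits q x F u" "splits q x G v"
  shows "splits q x (Bin (conn q) F G) (merge_parts q x u v)"
  using assms(1)
proof (cases rule: splits.cases)
  case F: splits_none
  show ?thesis
    using assms(2)
  proof (cases rule: splits.cases)
    case G: splits_none
    show ?thesis using F G by (auto simp: merge_parts_def intro: splits_none)
  next
    case G: (splits_all P)
    show ?thesis using F G
      by (auto simp: merge_parts_def intro!: splits_some rewrites_comm)
  next
    case G: (splits_some A B P)
    have "Bin (conn q) F G \<leadsto> Bin (conn q) A (Bin (conn q) F B)"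
      using rewrites_Bin_right[OF G(6), of "conn q" F] rewrites_left_comm by (rule rtrancl_trans)
    then show ?thesis using F G
      by (auto simp: merge_parts_def intro!: splits_some dest: free_in_all_imp_free)
  qed
next
  case F: (splits_all P)
  show ?thesis
    using assms(2)
  proof (cases rule: splits.cases)
    case G: splits_none
    show ?thesis using F G by (auto simp: merge_parts_def intro!: splits_some dest: free_in_all_imp_free)
  next
    case G: (splits_all P')
    show ?thesis using F G
      by (auto simp: merge_parts_def intro!: splits_all dest: free_in_all_imp_free)
  next
    case G: (splits_some A B P')
    have "Bin (conn q) F G \<leadsto> Bin (conn q) (Bin (conn q) F A) B"
      using rewrites_Bin_right[OF G(6), of "conn q" F] rewrites_assoc(2) by (rule rtrancl_trans)
    then show ?thesis using F G
      by (auto simp: merge_parts_def intro!: splits_some dest: free_in_all_imp_free)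
  qed
next
  case F: (splits_some A B P)
  show ?thesis
    using assms(2)
  proof (cases rule: splits.cases)
    case G: splits_none
    have "Bin (conn q) F G \<leadsto> Bin (conn q) A (Bin (conn q) B G)"
      using rewrites_Bin_left[OF F(6), of "conn q" G] rewrites_assoc(1) by (rule rtrancl_trans)
    then show ?thesis using F G by (auto simp: merge_parts_def intro!: splits_some dest: free_in_all_imp_free)
  next
    case G: (splits_all P')
    have "Bin (conn q) F G \<leadsto> Bin (conn q) (Bin (conn q) A G) B"
      using rewrites_Bin_left[OF F(6), of "conn q" G] rewrites_right_comm by (rule rtrancl_trans)
    then show ?thesis using F G
      by (auto simp: merge_parts_def intro!: splits_some dest: free_in_all_imp_free)
  next
    case G: (splits_some A' B' P')
    have "Bin (conn q) F G \<leadsto> Bin (conn q) (Bin (conn q) A A') (Bin (conn q) B B')"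
      using rewrites_Bin[OF F(6) G(6), of "conn q"] rewrites_interchange by (rule rtrancl_trans)
    then have "splits q x (Bin (conn q) F G)
        (Some (Bin (conn q) A A', Qu q x (Bin (conn q) A A')), Some (Bin (conn q) B B'))"
    proof (rule splits_some[rotated 4])
      show "free_in_all (conn q) y (Bin (conn q) A A') \<and>
          free_in_all (conn q) y (Qu q x (Bin (conn q) A A')) \<and>
          free_in_all (conn q) y (Bin (conn q) B B')"
        if "y \<noteq> x" "free_in_all (conn q) y (Bin (conn q) F G)" for y
        using that F(9)[of y] G(9)[of y] free_in_all_imp_free[of "conn q" y A] by simp
    qed (use F(2-5,8) G(2-5,8) in auto)
    then show ?thesis by (simp add: F(1) G(1) merge_parts_def)
  qed
qed

text \<open>The joined formula is a \<open>conn q\<close>-connective or \<open>Qu q x\<close> in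
  front of one, through which \<open>stuck\<close> looks. Either way \<open>y\<close> stays free in
  every component, by assumption or by the last conditions of \<open>splits\<close>.\<close>

lemma stuck_merge:
  assumes "splits q x F u" "splits q x G v"
    and "y \<noteq> x" "free_in_all (conn q) y F" "free_in_all (conn q) y G"
  shows "stuck q y (join_parts q (merge_parts q x u v))"
proof -
  have y: "y \<in> free F" "y \<in> free G"
    using assms(4,5) by (auto dest: free_in_all_imp_free)
  show ?thesis
    using assms(1)
  proof (cases rule: splits.cases)
    case F: splits_none
    show ?thesis using assms(2)
      by (cases rule: splits.cases) (use assms(3-5) F in \<open>auto simp: merge_parts_def join_parts_def dest: free_in_all_imp_free\<close>)
  next
    case F: (splits_all P)
    show ?thesis using assms(2)
      by (cases rule: splits.cases)
        (use assms(3-5) y F in \<open>auto simp: merge_parts_def join_parts_def dest: free_in_all_imp_free\<close>)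
  next
    case F: (splits_some A B P)
    show ?thesis using assms(2)
      by (cases rule: splits.cases)
        (use assms(3-5) y F in \<open>auto simp: merge_parts_def join_parts_def dest: free_in_all_imp_free\<close>)
  qed
qed

text \<open>The two claims are proved together: normality below a like quantifier on
  \<open>y\<close> needs the second one for the body.\<close>

lemma splits_parts:
  "splits q x F (parts q x F) \<and> (\<forall>y. y \<noteq> x \<longrightarrow> stuck q y F \<longrightarrow> stuck q y (push q x F))"
proof (induction F)
  case (Atom R xs)
  show ?case
    by (auto simp: push_def single_part_def join_parts_def intro: splits_none splits_all)
next
  case (Neg F)
  show ?case
    by (auto simp: push_def single_part_def join_parts_def intro: splits_none splits_all)
next
  case (Bin b F G)
  then have FG: "splits q x F (parts q x F)" "splits q x G (parts q x G)" by auto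
  show ?case
  proof (cases "b = conn q")
    case True
    then show ?thesis using splits_merge[OF FG] stuck_merge[OF FG] by (simp add: push_def)
  next
    case False
    have "Qu q x (Bin b F G) \<leadsto> Bin b (join_parts q (parts q x F)) (join_parts q (parts q x G))"
      using rewrites_distribute[OF False]
        rewrites_Bin[OF splits_join(2)[OF FG(1)] splits_join(2)[OF FG(2)]]
      by (rule rtrancl_trans)
    then have "splits q x (Bin b F G) (parts q x (Bin b F G))"
      using False splits_join(1,3)[OF FG(1)] splits_join(1,3)[OF FG(2)]
      by (simp, intro splits_single) auto
    with False show ?thesis by simp
  qed
next
  case (Qu q' y F)
  then have F: "splits q x F (parts q x F)" by auto
  show ?case
  proof (cases "q' = q")
    case True
    have "Qu q x (Qu q y F) \<leadsto> Qu q y (join_parts q (parts q x F))"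
      using rewrites_swap rewrites_Qu[OF splits_join(2)[OF F]] by (rule rtrancl_trans)
    \<comment> \<open>The premise comes from the second induction claim, as a normal
      \<open>Qu q y F\<close> has \<open>stuck q y F\<close>. For \<open>x = y\<close> the variable
      is not free in \<open>Qu q y F\<close>, and nothing is pushed.\<close>
    then have "splits q x (Qu q y F) (parts q x (Qu q y F))" if "x \<noteq> y \<longrightarrow> normal (Qu q y F) \<longrightarrow>
        stuck q y (join_parts q (parts q x F))"
      using that splits_join(1,3)[OF F] by (simp, intro splits_single) auto
    with True Qu show ?thesis by (auto simp: push_def single_part_def join_parts_def)
  next
    case False
    then have "splits q x (Qu q' y F) (parts q x (Qu q' y F))"
      by (simp, intro splits_single) auto
    with False show ?thesis by (auto simp: push_def single_part_def join_parts_def)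
  qed
qed

lemma push_correct:
  "free (push q x F) = free F - {x}" "Qu q x F \<leadsto> push q x F" "normal F \<Longrightarrow> normal (push q x F)"
  using splits_join[of q x F "parts q x F"] splits_parts[of q x F] by (auto simp: push_def)

lemma rewrites_nf: "pfo F \<Longrightarrow> F \<leadsto> nf F"
  by (induction F) (auto intro: rewrites_Bin rtrancl_trans[OF rewrites_Qu push_correct(2)])

lemma normal_nf: "normal (nf F)"
  by (induction F) (simp_all add: push_correct)

lemma normal_form_nf:
  assumes "F \<in> PFO"
  shows "nf F \<in> PFO \<and> normal_form_of system_Y (conv_class ACO F) (conv_class ACO (nf F))"
  using rewrites_imp_system_Y[OF rewrites_nf assms] assms normal_imp_no_system_Y_step[OF normal_nf]
  by (auto simp: normal_form_of_def PFO_def)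

section \<open>Structural recursion in polynomial time\<close>

lemma poly_computable_cases:
  assumes "poly_computable D i (\<lambda>a. enc_bool (P a))"
    and "poly_computable {a \<in> D. P a} i f" "poly_computable {a \<in> D. \<not> P a} i f"
  shows "poly_computable D i f"
  using poly_computable_If_restricted[OF assms] by simp

lemma poly_computable_disj:
  assumes "poly_computable D i (\<lambda>a. enc_bool (P a))" "poly_computable D i (\<lambda>a. enc_bool (Q a))"
  shows "poly_computable D i (\<lambda>a. enc_bool (P a \<or> Q a))"
  by (rule poly_computable_cong[OF poly_computable_If[OF assms(1) poly_computable_const[of _ _ "enc_bool True"] assms(2)]])
    auto

lemmas poly_computable_intros =
  poly_computable_const poly_computable_Node poly_computable_left poly_computable_right
  poly_computable_eq poly_computable_If poly_computable_disj

fun enc_binop :: "binop \<Rightarrow> tree" where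
  "enc_binop Conj = enc_nat 2"
| "enc_binop Disj = enc_nat 3"

fun enc_quant :: "quant \<Rightarrow> tree" where
  "enc_quant Ex = enc_nat 4"
| "enc_quant All = enc_nat 5"

lemma enc_fo_Bin: "enc_fo (Bin b F G) = Node (enc_binop b) (Node (enc_fo F) (enc_fo G))"
  and enc_fo_Qu: "enc_fo (Qu q x F) = Node (enc_quant q) (Node (enc_nat x) (enc_fo F))"
  by (cases b; cases q; simp)+

declare enc_fo.simps(3,4) [simp del]
declare enc_fo_Bin [simp] enc_fo_Qu [simp]

lemma enc_binop_eq_iff [simp]: "enc_binop b = enc_nat n \<longleftrightarrow> n = (if b = Conj then 2 else 3)"
  by (cases b) auto

lemma enc_quant_eq_iff [simp]: "enc_quant q = enc_nat n \<longleftrightarrow> n = (if q = Ex then 4 else 5)"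
  by (cases q) auto

lemma enc_binop_inj [simp]: "enc_binop b = enc_binop c \<longleftrightarrow> b = c"
  by (cases b; cases c) auto

lemma enc_quant_inj [simp]: "enc_quant b = enc_quant c \<longleftrightarrow> b = c"
  by (cases b; cases c) auto

primrec subs :: "fo \<Rightarrow> fo list" where
  "subs (Atom R xs) = []"
| "subs (Neg F) = []"
| "subs (Bin b F G) = [F, G]"
| "subs (Qu q x F) = [F]"

text \<open>For pfo-formulas, the number of subformula occurrences. The stack machine handles each
  twice, to expand it and to combine its values.\<close>

primrec subs_count :: "fo \<Rightarrow> nat" where
  "subs_count (Atom R xs) = 1"
| "subs_count (Neg F) = 1"
| "subs_count (Bin b F G) = subs_count F + subs_count G + 1"
| "subs_count (Qu q x F) = subs_count F + 1"

lemma subs_count_le: "subs_count F \<le> nodes (enc_fo F)"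
  by (induction F) auto

text \<open>A stack machine for structural recursion on formulas. An item \<open>(False, F)\<close> of the work stack
  asks for the value of \<open>F\<close>, an item \<open>(True, F)\<close> for its computation from the values of the immediate
  subformulas, which are on top of the value stack. The value stack lists the formulas instead of their
  values, which only appear in the encoding of the state.\<close>

fun fold_step :: "'p \<times> (bool \<times> fo) list \<times> fo list \<Rightarrow> 'p \<times> (bool \<times> fo) list \<times> fo list" where
  "fold_step (p, (False, F) # W, V) = (p, map (Pair False) (rev (subs F)) @ (True, F) # W, V)"
| "fold_step (p, (True, F) # W, V) = (p, W, F # drop (length (subs F)) V)"
| "fold_step (p, [], V) = (p, [], V)"

fun enc_state ::
    "('p \<Rightarrow> tree) \<Rightarrow> ('p \<Rightarrow> fo \<Rightarrow> tree) \<Rightarrow> 'p \<times> (bool \<times> fo) list \<times> fo list \<Rightarrow> tree" where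
  "enc_state ep val (p, W, V) =
     Node (enc_list (map (\<lambda>(b, F). Node (enc_bool b) (enc_fo F)) W))
       (Node (ep p) (enc_list (map (val p) V)))"

text \<open>The invariant under which a step can be computed: below an item to be combined, the
  topmost values are those of its immediate subformulas.\<close>

definition fold_states :: "('p \<times> (bool \<times> fo) list \<times> fo list) set" where
  "fold_states = {(p, (b, F) # W, V) | p b F W V. pfo F \<and> (b \<longrightarrow> (\<exists>V'. V = subs F @ V'))}"

text \<open>\<open>u\<close> pays for one work item and its value, with 6 nodes for the constructors
  around them and the flag \<open>True\<close>. Expanding a formula adds at most two items, later
  replaced by values, so \<open>3 * u\<close> per subformula occurrence suffices. The threshold
  \<open>m\<close> keeps \<open>u\<close> fixed while the induction descends.\<close>

lemma runs_fold_step: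
  assumes u: "\<And>H. pfo H \<Longrightarrow> nodes (enc_fo H) \<le> m \<Longrightarrow> nodes (enc_fo H) + nodes (val p H) + 6 \<le> u"
  shows "pfo F \<Longrightarrow> nodes (enc_fo F) \<le> m \<Longrightarrow>
    nodes (enc_state ep val (p, (False, F) # W, V)) + 3 * subs_count F * u \<le> S \<Longrightarrow>
    runs fold_step (enc_state ep val) fold_states S (2 * subs_count F) (p, (False, F) # W, V) (p, W, F # V)"
proof (induction F arbitrary: W V)
  case (Atom R xs)
  let ?F = "Atom R xs"
  have "6 \<le> u" using u[OF Atom(1,2)] by simp
  then have "runs fold_step (enc_state ep val) fold_states S (Suc (Suc 0))
      (p, (False, ?F) # W, V) (p, W, ?F # V)"
    using Atom by (intro runs_step) (auto simp: fold_states_def intro: runs_refl)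
  then show ?case by (simp add: numeral_2_eq_2)
next
  case (Bin b F G)
  let ?B = "Bin b F G"
  let ?runs = "runs fold_step (enc_state ep val) fold_states S"
  have pfo: "pfo F" "pfo G" and le: "nodes (enc_fo F) \<le> m" "nodes (enc_fo G) \<le> m"
    using Bin.prems by auto
  have uF: "nodes (enc_fo F) + nodes (val p F) + 6 \<le> u" and uG: "nodes (enc_fo G) + nodes (val p G) + 6 \<le> u"
    by (intro u pfo le)+
  let ?Z = "nodes (enc_state ep val (p, (False, ?B) # W, V))"
  have S: "?Z + 3 * u + 3 * (subs_count F * u) + 3 * (subs_count G * u) \<le> S"
    using Bin.prems(3) by (simp add: algebra_simps)
  \<comment> \<open>\<open>G\<close> is treated first, so that the value of \<open>F\<close> ends up
    on top and the value stack begins with \<open>subs ?B\<close>.\<close>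
  have "?runs (2 * subs_count G) (p, (False, G) # (False, F) # (True, ?B) # W, V)
      (p, (False, F) # (True, ?B) # W, G # V)"
    using uF uG S by (intro Bin.IH(2) pfo le) simp
  moreover have "?runs (2 * subs_count F) (p, (False, F) # (True, ?B) # W, G # V)
      (p, (True, ?B) # W, F # G # V)"
    using uF uG S by (intro Bin.IH(1) pfo le) simp
  moreover have "?runs 1 (p, (True, ?B) # W, F # G # V) (p, W, ?B # V)"
    using runs_step[OF _ _ _ runs_refl, where b = "(p, (True, ?B) # W, F # G # V)" and \<sigma> = fold_step
        and j = "enc_state ep val" and D = fold_states and S = S]
      Bin.prems(1) uF uG S by (auto simp: fold_states_def)
  ultimately have "?runs (2 * subs_count G + (2 * subs_count F + 1))
      (p, (False, G) # (False, F) # (True, ?B) # W, V) (p, W, ?B # V)"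
    by (blast intro: runs_trans)
  then have "?runs (Suc (2 * subs_count G + (2 * subs_count F + 1))) (p, (False, ?B) # W, V) (p, W, ?B # V)"
    using Bin.prems(1) S by (intro runs_step) (auto simp: fold_states_def)
  then show ?case by (simp add: algebra_simps)
next
  case (Qu q x F)
  let ?B = "Qu q x F"
  let ?runs = "runs fold_step (enc_state ep val) fold_states S"
  have pfo: "pfo F" and le: "nodes (enc_fo F) \<le> m"
    using Qu.prems by auto
  have uF: "nodes (enc_fo F) + nodes (val p F) + 6 \<le> u"
    by (intro u pfo le)
  let ?Z = "nodes (enc_state ep val (p, (False, ?B) # W, V))"
  have S: "?Z + 3 * u + 3 * (subs_count F * u) \<le> S"
    using Qu.prems(3) by (simp add: algebra_simps)
  have "?runs (2 * subs_count F) (p, (False, F) # (True, ?B) # W, V) (p, (True, ?B) # W, F # V)"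
    using uF S by (intro Qu.IH pfo le) simp
  moreover have "?runs 1 (p, (True, ?B) # W, F # V) (p, W, ?B # V)"
    using runs_step[OF _ _ _ runs_refl, where b = "(p, (True, ?B) # W, F # V)" and \<sigma> = fold_step
        and j = "enc_state ep val" and D = fold_states and S = S]
      Qu.prems(1) uF S by (auto simp: fold_states_def)
  ultimately have "?runs (2 * subs_count F + 1) (p, (False, F) # (True, ?B) # W, V) (p, W, ?B # V)"
    by (rule runs_trans)
  then have "?runs (Suc (2 * subs_count F + 1)) (p, (False, ?B) # W, V) (p, W, ?B # V)"
    using Qu.prems(1) S by (intro runs_step) (auto simp: fold_states_def)
  then show ?case by (simp add: algebra_simps)
qed auto

text \<open>Visiting an item only moves subtrees. For combining, the states are split by constructor
  and opened as tuples, whereupon all inputs lie at fixed positions of the encoding.\<close>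

lemma poly_computable_fold_step:
  assumes atom: "poly_computable UNIV (\<lambda>(p, R, xs). Node (ep p) (enc_fo (Atom R xs)))
      (\<lambda>(p, R, xs). val p (Atom R xs))"
    and bin: "poly_computable {(p, b, F, G). pfo F \<and> pfo G}
      (\<lambda>(p, b, F, G). Node (ep p) (Node (enc_fo (Bin b F G)) (Node (val p F) (val p G))))
      (\<lambda>(p, b, F, G). val p (Bin b F G))"
    and qu: "poly_computable {(p, q, x, F). pfo F}
      (\<lambda>(p, q, x, F). Node (ep p) (Node (enc_fo (Qu q x F)) (val p F)))
      (\<lambda>(p, q, x, F). val p (Qu q x F))"
  shows "poly_computable fold_states (enc_state ep val) (\<lambda>s. enc_state ep val (fold_step s))"
proof -
  let ?e = "enc_state ep val"
  \<comment> \<open>The path leads through the work stack and its first item to the constructor tag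
    of the formula.\<close>
  let ?tag = "\<lambda>s. left (right (left (left (?e s))))"
  let ?is_atom = "\<lambda>s. ?tag s = enc_nat 0"
  let ?is_bin = "\<lambda>s. ?tag s = enc_nat 2 \<or> ?tag s = enc_nat 3"
  have is_atom: "poly_computable D ?e (\<lambda>s. enc_bool (?is_atom s))"
    and is_bin: "poly_computable D ?e (\<lambda>s. enc_bool (?is_bin s))" for D
    by (intro poly_computable_intros poly_computable_input)+
  have visit: "poly_computable {s \<in> fold_states. left (left (left (?e s))) = Leaf} ?e (\<lambda>s. ?e (fold_step s))"
  proof (rule poly_computable_cong)
    let ?F = "\<lambda>s. right (left (left (?e s)))"
    let ?W = "\<lambda>s. Node (Node (Node Leaf Leaf) (?F s)) (right (left (?e s)))"
    show "poly_computable {s \<in> fold_states. left (left (left (?e s))) = Leaf} ?e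
      (\<lambda>s. Node (if ?is_atom s then ?W s
          else if ?is_bin s then Node (Node Leaf (right (right (?F s))))
            (Node (Node Leaf (left (right (?F s)))) (?W s))
          else Node (Node Leaf (right (right (?F s)))) (?W s)) (right (?e s)))"
      by (intro poly_computable_intros poly_computable_input)
    fix s assume "s \<in> {s \<in> fold_states. left (left (left (?e s))) = Leaf}"
    then obtain p F W V where s: "s = (p, (False, F) # W, V)" "pfo F"
      by (auto simp: fold_states_def)
    then show "Node (if ?is_atom s then ?W s
          else if ?is_bin s then Node (Node Leaf (right (right (?F s))))
            (Node (Node Leaf (left (right (?F s)))) (?W s))
          else Node (Node Leaf (right (right (?F s)))) (?W s)) (right (?e s)) = ?e (fold_step s)"
      by (cases F) auto
  qed
  let ?D = "{s \<in> fold_states. left (left (left (?e s))) \<noteq> Leaf}"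
  have build_atom: "poly_computable {s \<in> ?D. ?is_atom s} ?e (\<lambda>s. ?e (fold_step s))"
  proof (rule poly_computable_reparam)
    let ?r = "\<lambda>(p, R, xs, W, V). (p, (True, Atom R xs) # W, V)"
    show "{s \<in> ?D. ?is_atom s} \<subseteq> ?r ` UNIV"
    proof
      fix s assume "s \<in> {s \<in> ?D. ?is_atom s}"
      then obtain p F W V where "s = (p, (True, F) # W, V)" "pfo F" "?is_atom s"
        by (auto simp: fold_states_def)
      then show "s \<in> ?r ` UNIV" by (cases F) (auto simp: image_iff split: if_splits)
    qed
    have val: "poly_computable UNIV (\<lambda>z. ?e (?r z))
        (\<lambda>z. (\<lambda>(p, R, xs). val p (Atom R xs)) ((\<lambda>(p, R, xs, W, V). (p, R, xs)) z))"
    proof (rule poly_computable_comp[OF _ atom])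
      show "poly_computable UNIV (\<lambda>z. ?e (?r z))
        (\<lambda>z. (\<lambda>(p, R, xs). Node (ep p) (enc_fo (Atom R xs))) ((\<lambda>(p, R, xs, W, V). (p, R, xs)) z))"
        by (rule poly_computable_cong[where f = "\<lambda>z. Node (left (right (?e (?r z)))) (right (left (left (?e (?r z)))))"])
          (auto intro!: poly_computable_intros poly_computable_input)
    qed simp
    show "poly_computable UNIV (\<lambda>z. ?e (?r z)) (\<lambda>z. ?e (fold_step (?r z)))"
      by (rule poly_computable_cong[OF poly_computable_Node[OF
              poly_computable_right[OF poly_computable_left[OF poly_computable_input]]
              poly_computable_Node[OF poly_computable_left[OF poly_computable_right[OF poly_computable_input]]
                poly_computable_Node[OF val
                  poly_computable_right[OF poly_computable_right[OF poly_computable_input]]]]]])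
        auto
  qed
  have build_bin: "poly_computable {s \<in> {s \<in> ?D. \<not> ?is_atom s}. ?is_bin s} ?e (\<lambda>s. ?e (fold_step s))"
  proof (rule poly_computable_reparam)
    let ?r = "\<lambda>(p, b, F, G, W, V). (p, (True, Bin b F G) # W, F # G # V)"
    let ?E = "{(p, b, F, G, W, V). pfo F \<and> pfo G}"
    let ?h = "\<lambda>(p, b, F, G, W, V). (p, b, F, G)"
    show "{s \<in> {s \<in> ?D. \<not> ?is_atom s}. ?is_bin s} \<subseteq> ?r ` ?E"
    proof
      fix s assume "s \<in> {s \<in> {s \<in> ?D. \<not> ?is_atom s}. ?is_bin s}"
      then obtain p F W V where "s = (p, (True, F) # W, subs F @ V)" "pfo F" "?is_bin s"
        by (auto simp: fold_states_def)
      then show "s \<in> ?r ` ?E" by (cases F) (auto simp: image_iff split: if_splits)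
    qed
    have val: "poly_computable ?E (\<lambda>z. ?e (?r z)) (\<lambda>z. (\<lambda>(p, b, F, G). val p (Bin b F G)) (?h z))"
    proof (rule poly_computable_comp[OF _ bin])
      show "poly_computable ?E (\<lambda>z. ?e (?r z))
        (\<lambda>z. (\<lambda>(p, b, F, G). Node (ep p) (Node (enc_fo (Bin b F G)) (Node (val p F) (val p G)))) (?h z))"
        by (rule poly_computable_cong[where f = "\<lambda>z. Node (left (right (?e (?r z))))
            (Node (right (left (left (?e (?r z)))))
              (Node (left (right (right (?e (?r z))))) (left (right (right (right (?e (?r z))))))))"])
          (auto intro!: poly_computable_intros poly_computable_input)
    qed auto
    show "poly_computable ?E (\<lambda>z. ?e (?r z)) (\<lambda>z. ?e (fold_step (?r z)))"
      by (rule poly_computable_cong[OF poly_computable_Node[OF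
              poly_computable_right[OF poly_computable_left[OF poly_computable_input]]
              poly_computable_Node[OF poly_computable_left[OF poly_computable_right[OF poly_computable_input]]
                poly_computable_Node[OF val
                  poly_computable_right[OF poly_computable_right[OF
                    poly_computable_right[OF poly_computable_right[OF poly_computable_input]]]]]]]])
        auto
  qed
  have build_qu: "poly_computable {s \<in> {s \<in> ?D. \<not> ?is_atom s}. \<not> ?is_bin s} ?e (\<lambda>s. ?e (fold_step s))"
  proof (rule poly_computable_reparam)
    let ?r = "\<lambda>(p, q, x, F, W, V). (p, (True, Qu q x F) # W, F # V)"
    let ?E = "{(p, q, x, F, W, V). pfo F}"
    let ?h = "\<lambda>(p, q, x, F, W, V). (p, q, x, F)"
    show "{s \<in> {s \<in> ?D. \<not> ?is_atom s}. \<not> ?is_bin s} \<subseteq> ?r ` ?E"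
    proof
      fix s assume "s \<in> {s \<in> {s \<in> ?D. \<not> ?is_atom s}. \<not> ?is_bin s}"
      then obtain p F W V where "s = (p, (True, F) # W, subs F @ V)" "pfo F" "\<not> ?is_atom s" "\<not> ?is_bin s"
        by (auto simp: fold_states_def)
      then show "s \<in> ?r ` ?E" by (cases F) (auto simp: image_iff split: if_splits)
    qed
    have val: "poly_computable ?E (\<lambda>z. ?e (?r z)) (\<lambda>z. (\<lambda>(p, q, x, F). val p (Qu q x F)) (?h z))"
    proof (rule poly_computable_comp[OF _ qu])
      show "poly_computable ?E (\<lambda>z. ?e (?r z))
        (\<lambda>z. (\<lambda>(p, q, x, F). Node (ep p) (Node (enc_fo (Qu q x F)) (val p F))) (?h z))"
        by (rule poly_computable_cong[where f = "\<lambda>z. Node (left (right (?e (?r z))))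
            (Node (right (left (left (?e (?r z))))) (left (right (right (?e (?r z))))))"])
          (auto intro!: poly_computable_intros poly_computable_input)
    qed auto
    show "poly_computable ?E (\<lambda>z. ?e (?r z)) (\<lambda>z. ?e (fold_step (?r z)))"
      by (rule poly_computable_cong[OF poly_computable_Node[OF
              poly_computable_right[OF poly_computable_left[OF poly_computable_input]]
              poly_computable_Node[OF poly_computable_left[OF poly_computable_right[OF poly_computable_input]]
                poly_computable_Node[OF val
                  poly_computable_right[OF poly_computable_right[OF
                    poly_computable_right[OF poly_computable_input]]]]]]])
        auto
  qed
  show ?thesis
    by (rule poly_computable_cases[OF _ visit poly_computable_cases[OF is_atom build_atom
            poly_computable_cases[OF is_bin build_bin build_qu]]])
      (intro poly_computable_intros poly_computable_input)
qed

text \<open>Primitive recursion with a fixed parameter \<open>p\<close>: the step sees the formula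
  itself besides the values of its subformulas. The assumption \<open>size\<close> excludes
  recursions whose values explode although each step is polynomial.\<close>

lemma poly_computable_fold:
  fixes val :: "'p \<Rightarrow> fo \<Rightarrow> tree"
  assumes atom: "poly_computable UNIV (\<lambda>(p, R, xs). Node (ep p) (enc_fo (Atom R xs)))
      (\<lambda>(p, R, xs). val p (Atom R xs))"
    and bin: "poly_computable {(p, b, F, G). pfo F \<and> pfo G}
      (\<lambda>(p, b, F, G). Node (ep p) (Node (enc_fo (Bin b F G)) (Node (val p F) (val p G))))
      (\<lambda>(p, b, F, G). val p (Bin b F G))"
    and qu: "poly_computable {(p, q, x, F). pfo F}
      (\<lambda>(p, q, x, F). Node (ep p) (Node (enc_fo (Qu q x F)) (val p F)))
      (\<lambda>(p, q, x, F). val p (Qu q x F))"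
    and size: "poly_bounded {(p, F). pfo F} (\<lambda>(p, F). Node (ep p) (enc_fo F)) (\<lambda>(p, F). nodes (val p F))"
  shows "poly_computable {(p, F). pfo F} (\<lambda>(p, F). Node (ep p) (enc_fo F)) (\<lambda>(p, F). val p F)"
proof -
  let ?D = "{(p :: 'p, F). pfo F}" and ?i = "\<lambda>(p, F). Node (ep p) (enc_fo F)"
  let ?e = "enc_state ep val"
  obtain k where k: "\<And>p F. pfo F \<Longrightarrow> nodes (val p F) \<le> Suc (nodes (Node (ep p) (enc_fo F))) ^ k"
    using poly_boundedE[OF size] by fastforce
  define u where "u a = nodes (?i a) + (nodes (?i a) + 1) ^ k + 6" for a
  define N where "N a = 2 * subs_count (snd a)" for a :: "'p \<times> fo"
  \<comment> \<open>The input plus 8 covers the initial state; the rest is \<open>3 * u\<close> per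
    subformula occurrence, whose number is at most the size of the input.\<close>
  define S where "S a = nodes (?i a) + 8 + 3 * nodes (?i a) * u a" for a
  have u: "poly_bounded ?D ?i u"
    unfolding u_def by (intro poly_bounded_intros poly_bounded_power)
  have "poly_computable ?D ?i (\<lambda>a. ?e ((\<lambda>(p, F). (p, [], [F])) a))"
  proof (rule poly_computable_loop[where j = ?e and h = "\<lambda>(p, F). (p, [(False, F)], [])" and
        r = "\<lambda>(p, F). (p, [], [F])"])
    show "poly_computable fold_states ?e (\<lambda>s. ?e (fold_step s))"
      by (rule poly_computable_fold_step[OF atom bin qu])
    show "poly_computable ?D ?i (\<lambda>a. ?e ((\<lambda>(p, F). (p, [(False, F)], [])) a))"
      by (rule poly_computable_cong[where f = "\<lambda>a. Node (Node (Node Leaf (right (?i a))) Leaf)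
            (Node (left (?i a)) Leaf)"])
        (auto intro!: poly_computable_intros poly_computable_input)
    have "poly_bounded ?D ?i (\<lambda>a. 2 * nodes (?i a))"
      by (intro poly_bounded_intros)
    then show "poly_bounded ?D ?i N"
    proof (rule poly_bounded_mono)
      show "a \<in> ?D \<and> N a \<le> 2 * nodes (?i a)" if "a \<in> ?D" for a
        using that subs_count_le[of "snd a"] by (auto simp: N_def)
    qed
    show "poly_bounded ?D ?i S"
      unfolding S_def by (intro poly_bounded_intros u)
    fix a assume a: "a \<in> ?D"
    obtain p F where [simp]: "a = (p, F)" by (cases a)
    have *: "nodes (enc_fo H) + nodes (val p H) + 6 \<le> u a" if "pfo H" "nodes (enc_fo H) \<le> nodes (enc_fo F)" for H
    proof -
      have "Suc (nodes (Node (ep p) (enc_fo H))) ^ k \<le> (nodes (?i a) + 1) ^ k"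
        using that(2) by (intro power_mono) auto
      then show ?thesis using k[OF that(1), of p] that(2) by (simp add: u_def)
    qed
    have "nodes (?e (p, [(False, F)], [])) + 3 * subs_count F * u a \<le> S a"
      unfolding S_def using subs_count_le[of F] by (intro add_mono mult_le_mono) auto
    from runs_fold_step[where val = val and p = p and u = "u a" and F = F and m = "nodes (enc_fo F)", OF * _ _ this]
    show "runs fold_step ?e fold_states (S a) (N a) ((\<lambda>(p, F). (p, [(False, F)], [])) a)
        ((\<lambda>(p, F). (p, [], [F])) a)"
      using a by (simp add: N_def)
    show "left (?e ((\<lambda>(p, F). (p, [], [F])) a)) = Leaf" by simp
  next
    have "poly_bounded ?D ?i (\<lambda>a. nodes (?i a) + (\<lambda>(p, F). nodes (val p F)) a + 5)"
      by (intro poly_bounded_intros size)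
    then show "poly_bounded ?D ?i (\<lambda>a. nodes (?e ((\<lambda>(p, F). (p, [], [F])) a)))"
      by (rule poly_bounded_mono) auto
  qed
  then have "poly_computable ?D ?i (\<lambda>a. left (right (right (?e ((\<lambda>(p, F). (p, [], [F])) a)))))"
    by (intro poly_computable_intros)
  then show ?thesis by (rule poly_computable_cong) auto
qed

section \<open>Computing the normal form in polynomial time\<close>

lemma poly_computable_member:
  "poly_computable UNIV (\<lambda>(x, xs). Node (enc_nat x) (enc_list (map enc_nat xs)))
     (\<lambda>(x, xs). enc_bool (x \<in> set xs))"
proof -
  let ?i = "\<lambda>(x, xs). Node (enc_nat x) (enc_list (map enc_nat xs))"
  let ?e = "\<lambda>(x, xs, r). Node (enc_list (map enc_nat xs)) (Node (enc_nat x) (enc_bool r))"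
  let ?\<sigma> = "\<lambda>(x, xs, r). (x, tl xs, r \<or> hd xs = x)"
  let ?D = "{(x, xs, r). xs \<noteq> []}"
  \<comment> \<open>A state with the unread list complete and the flag \<open>True\<close> has
    exactly 4 nodes more than the input.\<close>
  let ?S = "\<lambda>a. nodes (?i a) + 4"
  have runs: "nodes (?e (x, xs, r)) \<le> S \<Longrightarrow> nodes (?e (x, xs, True)) \<le> S \<Longrightarrow>
      runs ?\<sigma> ?e ?D S (length xs) (x, xs, r) (x, [], r \<or> x \<in> set xs)" for x xs r S
  proof (induction xs arbitrary: r)
    case (Cons y xs)
    have "nodes (?e (x, xs, r')) \<le> S" for r'
      using Cons.prems by (cases r') auto
    from Cons.IH[OF this this, of "r \<or> y = x"]
    have "runs ?\<sigma> ?e ?D S (length xs) (?\<sigma> (x, y # xs, r)) (x, [], (r \<or> y = x) \<or> x \<in> set xs)"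
      by simp
    moreover have "((r \<or> y = x) \<or> x \<in> set xs) = (r \<or> x \<in> set (y # xs))" by auto
    ultimately show ?case
      unfolding length_Cons using Cons.prems by (intro runs_step) auto
  qed (simp add: runs_refl)
  have len: "length xs \<le> nodes (?i (x, xs))" for x xs
    by (induction xs) auto
  have "poly_computable UNIV ?i (\<lambda>a. ?e ((\<lambda>(x, xs). (x, [], x \<in> set xs)) a))"
  proof (rule poly_computable_loop[where j = ?e and h = "\<lambda>(x, xs). (x, xs, False)"
        and r = "\<lambda>(x, xs). (x, [], x \<in> set xs)" and \<sigma> = ?\<sigma> and D' = ?D
        and N = "\<lambda>(x, xs). length xs" and S = ?S])
    show "poly_computable UNIV ?i (\<lambda>a. ?e ((\<lambda>(x, xs). (x, xs, False)) a))"
      by (rule poly_computable_cong[where f = "\<lambda>a. Node (right (?i a)) (Node (left (?i a)) Leaf)"])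
        (auto intro!: poly_computable_intros poly_computable_input)
    show "poly_computable ?D ?e (\<lambda>s. ?e (?\<sigma> s))"
    proof (rule poly_computable_cong)
      show "poly_computable ?D ?e (\<lambda>s. Node (right (left (?e s))) (Node (left (right (?e s)))
          (enc_bool (right (right (?e s)) = Node Leaf Leaf \<or> left (left (?e s)) = left (right (?e s))))))"
        by (intro poly_computable_intros poly_computable_input)
    qed (auto simp: neq_Nil_conv enc_bool_def split: if_splits)
    show "poly_bounded UNIV ?i ?S" by (intro poly_bounded_intros)
    show "poly_bounded UNIV ?i (\<lambda>(x, xs). length xs)"
      by (rule poly_bounded_mono[OF poly_bounded_nodes]) (use len in auto)
    show "poly_bounded UNIV ?i (\<lambda>a. nodes (?e ((\<lambda>(x, xs). (x, [], x \<in> set xs)) a)))"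
      by (rule poly_bounded_mono[of UNIV _ ?S]) (auto simp: enc_bool_def Suc_le_eq intro!: poly_bounded_intros)
    show "runs ?\<sigma> ?e ?D (?S a) ((\<lambda>(x, xs). length xs) a) ((\<lambda>(x, xs). (x, xs, False)) a)
        ((\<lambda>(x, xs). (x, [], x \<in> set xs)) a)" for a
      using runs[of "fst a" "snd a" False "?S a"] by (cases a) simp
  qed auto
  then have "poly_computable UNIV ?i (\<lambda>a. right (right (?e ((\<lambda>(x, xs). (x, [], x \<in> set xs)) a))))"
    by (intro poly_computable_intros)
  then show ?thesis by (rule poly_computable_cong) auto
qed

lemma poly_computable_free_param:
  "poly_computable {(x, F). pfo F} (\<lambda>(x, F). Node (enc_nat x) (enc_fo F)) (\<lambda>(x, F). enc_bool (x \<in> free F))"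
proof (rule poly_computable_fold)
  let ?i = "\<lambda>(x, R, xs). Node (enc_nat x) (enc_fo (Atom R xs))"
  have "poly_computable UNIV ?i
      (\<lambda>a. (\<lambda>(x, xs). enc_bool (x \<in> set xs)) ((\<lambda>(x, R, xs). (x, xs)) a))"
  proof (rule poly_computable_comp[OF _ poly_computable_member])
    show "poly_computable UNIV ?i
      (\<lambda>a. (\<lambda>(x, xs). Node (enc_nat x) (enc_list (map enc_nat xs))) ((\<lambda>(x, R, xs). (x, xs)) a))"
      by (rule poly_computable_cong[where f = "\<lambda>a. Node (left (?i a)) (right (right (right (?i a))))"])
        (auto intro!: poly_computable_intros poly_computable_input)
  qed simp
  then show "poly_computable UNIV ?i (\<lambda>(x, R, xs). enc_bool (x \<in> free (Atom R xs)))"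
    by (rule poly_computable_cong) auto
next
  let ?i = "\<lambda>(x, b, F, G). Node (enc_nat x) (Node (enc_fo (Bin b F G))
      (Node (enc_bool (x \<in> free F)) (enc_bool (x \<in> free G))))"
  show "poly_computable {(x, b, F, G). pfo F \<and> pfo G} ?i (\<lambda>(x, b, F, G). enc_bool (x \<in> free (Bin b F G)))"
    by (rule poly_computable_cong[where f = "\<lambda>a. if left (right (right (?i a))) = Leaf
        then right (right (right (?i a))) else Node Leaf Leaf"])
      (auto intro!: poly_computable_intros poly_computable_input)
next
  let ?i = "\<lambda>(x, q, y, F). Node (enc_nat x) (Node (enc_fo (Qu q y F)) (enc_bool (x \<in> free F)))"
  show "poly_computable {(x, q, y, F). pfo F} ?i (\<lambda>(x, q, y, F). enc_bool (x \<in> free (Qu q y F)))"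
    by (rule poly_computable_cong[where f = "\<lambda>a. if left (?i a) = left (right (left (right (?i a))))
        then Leaf else right (right (?i a))"])
      (auto intro!: poly_computable_intros poly_computable_input)
next
  show "poly_bounded {(x, F). pfo F} (\<lambda>(x, F). Node (enc_nat x) (enc_fo F))
      (\<lambda>(x, F). nodes (enc_bool (x \<in> free F)))"
    by (rule poly_bounded_mono[OF poly_bounded_const[of _ _ 3]]) (auto simp: enc_bool_def)
qed

lemma poly_computable_free:
  assumes "poly_computable D i (\<lambda>a. enc_nat (x a))" "poly_computable D i (\<lambda>a. enc_fo (F a))"
    and "\<And>a. a \<in> D \<Longrightarrow> pfo (F a)"
  shows "poly_computable D i (\<lambda>a. enc_bool (x a \<in> free (F a)))"
proof -
  have "poly_computable D i (\<lambda>a. (\<lambda>(x, F). enc_bool (x \<in> free F)) ((\<lambda>a. (x a, F a)) a))"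
    by (rule poly_computable_comp[OF _ poly_computable_free_param])
      (use assms in \<open>auto intro: poly_computable_Node\<close>)
  then show ?thesis by simp
qed

lemma poly_computable_Bin:
  assumes "poly_computable D i (\<lambda>a. enc_binop (b a))" "poly_computable D i (\<lambda>a. enc_fo (F a))"
    "poly_computable D i (\<lambda>a. enc_fo (G a))"
  shows "poly_computable D i (\<lambda>a. enc_fo (Bin (b a) (F a) (G a)))"
  unfolding enc_fo_Bin by (intro poly_computable_Node assms)

lemma poly_computable_Qu:
  assumes "poly_computable D i (\<lambda>a. enc_quant (q a))" "poly_computable D i (\<lambda>a. enc_nat (x a))"
    "poly_computable D i (\<lambda>a. enc_fo (F a))"
  shows "poly_computable D i (\<lambda>a. enc_fo (Qu (q a) (x a) (F a)))"
  unfolding enc_fo_Qu by (intro poly_computable_Node assms)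

lemma poly_computable_conn:
  assumes "poly_computable D i (\<lambda>a. enc_quant (q a))"
  shows "poly_computable D i (\<lambda>a. enc_binop (conn (q a)))"
proof (rule poly_computable_cong)
  show "poly_computable D i (\<lambda>a. if enc_quant (q a) = enc_nat 4 then enc_nat 2 else enc_nat 3)"
    by (intro poly_computable_intros assms)
  show "(if enc_quant (q a) = enc_nat 4 then enc_nat 2 else enc_nat 3) = enc_binop (conn (q a))" for a
    by (cases "q a") auto
qed

text \<open>\<open>Leaf\<close> can stand for \<open>None\<close>, because neither a formula nor a
  pair is encoded by it.\<close>

definition enc_parts :: "(fo \<times> fo) option \<times> fo option \<Rightarrow> tree" where
  "enc_parts u =
     Node (case fst u of None \<Rightarrow> Leaf | Some (A, P) \<Rightarrow> Node (enc_fo A) (enc_fo P))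
       (case snd u of None \<Rightarrow> Leaf | Some B \<Rightarrow> enc_fo B)"

lemma enc_fo_neq_Leaf [simp]: "enc_fo F \<noteq> Leaf"
  by (cases F) auto

lemma poly_computable_single_part:
  assumes "poly_computable D i (\<lambda>a. enc_nat (x a))" "poly_computable D i (\<lambda>a. enc_fo (F a))"
    "poly_computable D i (\<lambda>a. enc_fo (P a))" "\<And>a. a \<in> D \<Longrightarrow> pfo (F a)"
  shows "poly_computable D i (\<lambda>a. enc_parts (single_part (x a) (F a) (P a)))"
proof (rule poly_computable_cong)
  show "poly_computable D i (\<lambda>a. if x a \<in> free (F a) then Node (Node (enc_fo (F a)) (enc_fo (P a))) Leaf
      else Node Leaf (enc_fo (F a)))"
    by (intro poly_computable_intros poly_computable_free assms)
qed (auto simp: enc_parts_def single_part_def)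

lemma poly_computable_merge_parts:
  assumes u: "poly_computable D i (\<lambda>a. enc_parts (u a))" and v: "poly_computable D i (\<lambda>a. enc_parts (v a))"
    and q: "poly_computable D i (\<lambda>a. enc_quant (q a))" and x: "poly_computable D i (\<lambda>a. enc_nat (x a))"
  shows "poly_computable D i (\<lambda>a. enc_parts (merge_parts (q a) (x a) (u a) (v a)))"
proof (rule poly_computable_cong)
  let ?u = "\<lambda>a. enc_parts (u a)" and ?v = "\<lambda>a. enc_parts (v a)"
  let ?b = "\<lambda>a. enc_binop (conn (q a))"
  let ?A = "\<lambda>a. Node (?b a) (Node (left (left (?u a))) (left (left (?v a))))"
  show "poly_computable D i (\<lambda>a. Node
     (if left (?u a) = Leaf then left (?v a) else if left (?v a) = Leaf then left (?u a)
      else Node (?A a) (Node (enc_quant (q a)) (Node (enc_nat (x a)) (?A a))))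
     (if right (?u a) = Leaf then right (?v a) else if right (?v a) = Leaf then right (?u a)
      else Node (?b a) (Node (right (?u a)) (right (?v a)))))"
    by (intro poly_computable_intros poly_computable_conn assms)
qed (auto simp: enc_parts_def merge_parts_def split: option.splits)

text \<open>On \<open>(None, None)\<close> the value of \<open>join_parts\<close> is the unspecified
  \<open>the None\<close>, which no program can be shown to output; hence the assumption
  \<open>defined\<close>.\<close>

lemma poly_computable_join_parts:
  assumes u: "poly_computable D i (\<lambda>a. enc_parts (u a))"
    and q: "poly_computable D i (\<lambda>a. enc_quant (q a))"
    and defined: "\<And>a. a \<in> D \<Longrightarrow> u a \<noteq> (None, None)"
  shows "poly_computable D i (\<lambda>a. enc_fo (join_parts (q a) (u a)))"
proof (rule poly_computable_cong)
  let ?u = "\<lambda>a. enc_parts (u a)"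
  show "poly_computable D i (\<lambda>a. if left (?u a) = Leaf then right (?u a)
      else if right (?u a) = Leaf then right (left (?u a))
      else Node (enc_binop (conn (q a))) (Node (right (left (?u a))) (right (?u a))))"
    by (intro poly_computable_intros poly_computable_conn assms)
  show "(if left (?u a) = Leaf then right (?u a)
      else if right (?u a) = Leaf then right (left (?u a))
      else Node (enc_binop (conn (q a))) (Node (right (left (?u a))) (right (?u a)))) =
      enc_fo (join_parts (q a) (u a))" if "a \<in> D" for a
    using defined[OF that]
    by (cases "u a") (auto simp: enc_parts_def join_parts_def split: option.splits)
qed

lemma parts_neq_None: "parts q x F \<noteq> (None, None)"
  using splits_parts[of q x F] by (auto elim: splits.cases)

section \<open>Size of pushed formulas\<close>

primrec atoms :: "fo \<Rightarrow> nat" where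
  "atoms (Atom R xs) = 1"
| "atoms (Neg F) = atoms F"
| "atoms (Bin b F G) = atoms F + atoms G"
| "atoms (Qu q x F) = atoms F"

lemma atoms_pos: "1 \<le> atoms F"
  by (induction F) auto

lemma atoms_le: "atoms F \<le> nodes (enc_fo F)"
  by (induction F) auto

definition quant_size :: "quant \<Rightarrow> nat \<Rightarrow> nat" where
  "quant_size q x = 2 + nodes (enc_quant q) + nodes (enc_nat x)"

lemma nodes_Qu: "nodes (enc_fo (Qu q x F)) = nodes (enc_fo F) + quant_size q x"
  by (simp add: quant_size_def)

text \<open>The surcharge of \<open>P\<close> is measured by the atoms of \<open>A\<close> alone, so
  that the surcharges of the two sides of a connective add up. Different copies of
  \<open>Qu q x\<close> have disjoint, nonempty sets of atoms below them.\<close>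

inductive splits_size :: "quant \<Rightarrow> nat \<Rightarrow> fo \<Rightarrow> (fo \<times> fo) option \<times> fo option \<Rightarrow> bool"
  for q x F where
  splits_size_none: "splits_size q x F (None, Some F)"
| splits_size_all:
    "atoms P = atoms F \<Longrightarrow> nodes (enc_fo P) \<le> nodes (enc_fo F) + atoms F * quant_size q x \<Longrightarrow>
     splits_size q x F (Some (F, P), None)"
| splits_size_some:
    "atoms A + atoms B = atoms F \<Longrightarrow> nodes (enc_fo (Bin (conn q) A B)) = nodes (enc_fo F) \<Longrightarrow>
     atoms P = atoms A \<Longrightarrow> nodes (enc_fo P) \<le> nodes (enc_fo A) + atoms A * quant_size q x \<Longrightarrow>
     splits_size q x F (Some (A, P), Some B)"

lemma splits_size_join:
  assumes "splits_size q x F u"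
  shows "atoms (join_parts q u) = atoms F"
    and "nodes (enc_fo (join_parts q u)) \<le> nodes (enc_fo F) + atoms F * quant_size q x"
proof -
  show "atoms (join_parts q u) = atoms F"
    using assms by (cases rule: splits_size.cases) (auto simp: join_parts_def)
  show "nodes (enc_fo (join_parts q u)) \<le> nodes (enc_fo F) + atoms F * quant_size q x"
    using assms
  proof (cases rule: splits_size.cases)
    case (splits_size_some A B P)
    have "atoms A * quant_size q x \<le> atoms F * quant_size q x"
      using splits_size_some by (intro mult_le_mono1) simp
    then have "nodes (enc_fo (Bin (conn q) P B)) \<le> nodes (enc_fo F) + atoms F * quant_size q x"
      using splits_size_some(3,5) unfolding enc_fo_Bin nodes.simps by linarith
    then show ?thesis using splits_size_some(1) by (simp add: join_parts_def)
  qed (auto simp: join_parts_def)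
qed

lemma splits_size_single:
  "atoms P = atoms F \<Longrightarrow> nodes (enc_fo P) \<le> nodes (enc_fo F) + atoms F * quant_size q x \<Longrightarrow>
    splits_size q x F (single_part x F P)"
  by (auto simp: single_part_def intro: splits_size.intros)

text \<open>A quantifier that stops is a single copy, paid for by any one atom below it.\<close>

lemma nodes_Qu_le: "nodes (enc_fo (Qu q x F)) \<le> nodes (enc_fo F) + atoms F * quant_size q x"
  unfolding nodes_Qu using mult_le_mono1[OF atoms_pos, of "quant_size q x" F] by simp

lemma splits_size_merge:
  assumes "splits_size q x F u" "splits_size q x G v"
  shows "splits_size q x (Bin (conn q) F G) (merge_parts q x u v)"
  using assms(1)
proof (cases rule: splits_size.cases)
  case F: splits_size_none
  from assms(2) F show ?thesis
    by (cases rule: splits_size.cases) (auto simp: merge_parts_def intro!: splits_size.intros)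
next
  case F: (splits_size_all P)
  from assms(2) F show ?thesis
    by (cases rule: splits_size.cases)
      (auto simp: merge_parts_def simp del: enc_fo_Qu intro!: splits_size.intros nodes_Qu_le)
next
  case F: (splits_size_some A B P)
  from assms(2) F show ?thesis
    by (cases rule: splits_size.cases)
      (auto simp: merge_parts_def simp del: enc_fo_Qu intro!: splits_size.intros nodes_Qu_le)
qed

lemma splits_size_parts: "splits_size q x F (parts q x F)"
proof (induction F)
  case (Bin b F G)
  show ?case
  proof (cases "b = conn q")
    case True
    then show ?thesis using splits_size_merge[OF Bin] by simp
  next
    case False
    then show ?thesis
      using splits_size_join[OF Bin(1)] splits_size_join[OF Bin(2)]
      by (auto simp: algebra_simps intro!: splits_size_single)
  qed
next
  case (Qu q' y F)
  then show ?case
    using splits_size_join[OF Qu] nodes_Qu_le[of q x "Qu q' y F"]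
    by (auto simp del: enc_fo_Qu simp: nodes_Qu intro!: splits_size_single)
qed (auto intro!: splits_size_single simp del: enc_fo_Qu simp: nodes_Qu atoms_pos[simplified])

lemma nodes_push_le: "nodes (enc_fo (push q x F)) \<le> nodes (enc_fo F) + atoms F * quant_size q x"
  and atoms_push: "atoms (push q x F) = atoms F"
  using splits_size_join[OF splits_size_parts] by (simp_all add: push_def)

text \<open>\<open>A\<close>, \<open>B\<close> and \<open>P\<close> without its surcharge are each
  no larger than \<open>F\<close>, which explains the factor 3.\<close>

lemma nodes_parts_le: "nodes (enc_parts (parts q x F)) \<le> 3 * nodes (enc_fo F) + nodes (enc_fo F) * quant_size q x + 5"
proof -
  have "atoms F * quant_size q x \<le> nodes (enc_fo F) * quant_size q x"
    by (intro mult_le_mono1 atoms_le)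
  with splits_size_parts[of q x F] show ?thesis
  proof (cases rule: splits_size.cases)
    case (splits_size_some A B P)
    then have "atoms A * quant_size q x \<le> atoms F * quant_size q x"
      by (intro mult_le_mono1) simp
    with splits_size_some(3,5) \<open>atoms F * quant_size q x \<le> _\<close>
    have "nodes (enc_fo A) + nodes (enc_fo P) + nodes (enc_fo B) + 5 \<le>
        3 * nodes (enc_fo F) + nodes (enc_fo F) * quant_size q x + 5"
      unfolding enc_fo_Bin nodes.simps by linarith
    then show ?thesis using splits_size_some(1) by (simp add: enc_parts_def)
  next
    case (splits_size_all P)
    with \<open>atoms F * quant_size q x \<le> _\<close>
    have "nodes (enc_fo P) \<le> nodes (enc_fo F) + nodes (enc_fo F) * quant_size q x"
      by linarith
    then show ?thesis using splits_size_all(1) by (simp add: enc_parts_def)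
  qed (auto simp: enc_parts_def)
qed

text \<open>The fold computes \<open>parts\<close> rather than \<open>push\<close>, because the
  clause for \<open>conn q\<close> cannot be evaluated from pushed formulas alone.\<close>

lemma poly_computable_parts_param:
  "poly_computable {(p, F). pfo F} (\<lambda>(p, F). Node (Node (enc_quant (fst p)) (enc_nat (snd p))) (enc_fo F))
     (\<lambda>(p, F). enc_parts (parts (fst p) (snd p) F))"
proof (rule poly_computable_fold)
  let ?ep = "\<lambda>p. Node (enc_quant (fst p)) (enc_nat (snd p))"
  let ?i = "\<lambda>(p, R, xs). Node (?ep p) (enc_fo (Atom R xs))"
  have q: "poly_computable UNIV ?i (\<lambda>a. enc_quant (fst (fst a)))"
    by (rule poly_computable_cong[where f = "\<lambda>a. left (left (?i a))"])
      (auto intro!: poly_computable_intros poly_computable_input)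
  have x: "poly_computable UNIV ?i (\<lambda>a. enc_nat (snd (fst a)))"
    by (rule poly_computable_cong[where f = "\<lambda>a. right (left (?i a))"])
      (auto intro!: poly_computable_intros poly_computable_input)
  have F: "poly_computable UNIV ?i (\<lambda>a. enc_fo (Atom (fst (snd a)) (snd (snd a))))"
    by (rule poly_computable_cong[where f = "\<lambda>a. right (?i a)"])
      (auto intro!: poly_computable_intros poly_computable_input)
  show "poly_computable UNIV ?i (\<lambda>(p, R, xs). enc_parts (parts (fst p) (snd p) (Atom R xs)))"
    by (rule poly_computable_cong[OF poly_computable_single_part[OF x F poly_computable_Qu[OF q x F]]]) auto
next
  let ?ep = "\<lambda>p. Node (enc_quant (fst p)) (enc_nat (snd p))"
  let ?v = "\<lambda>p F. enc_parts (parts (fst p) (snd p) F)"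
  let ?i = "\<lambda>(p, b, F, G). Node (?ep p) (Node (enc_fo (Bin b F G)) (Node (?v p F) (?v p G)))"
  let ?D = "{(p :: quant \<times> nat, b, F, G). pfo F \<and> pfo G}"
  let ?F = "\<lambda>a. fst (snd (snd a))" and ?G = "\<lambda>a. snd (snd (snd a))"
  have q: "poly_computable ?D ?i (\<lambda>a. enc_quant (fst (fst a)))"
    by (rule poly_computable_cong[where f = "\<lambda>a. left (left (?i a))"])
      (auto intro!: poly_computable_intros poly_computable_input)
  have x: "poly_computable ?D ?i (\<lambda>a. enc_nat (snd (fst a)))"
    by (rule poly_computable_cong[where f = "\<lambda>a. right (left (?i a))"])
      (auto intro!: poly_computable_intros poly_computable_input)
  have b: "poly_computable ?D ?i (\<lambda>a. enc_binop (fst (snd a)))"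
    by (rule poly_computable_cong[where f = "\<lambda>a. left (left (right (?i a)))"])
      (auto intro!: poly_computable_intros poly_computable_input)
  have B: "poly_computable ?D ?i (\<lambda>a. enc_fo (Bin (fst (snd a)) (?F a) (?G a)))"
    by (rule poly_computable_cong[where f = "\<lambda>a. left (right (?i a))"])
      (auto intro!: poly_computable_intros poly_computable_input)
  have F: "poly_computable ?D ?i (\<lambda>a. enc_parts (parts (fst (fst a)) (snd (fst a)) (?F a)))"
    by (rule poly_computable_cong[where f = "\<lambda>a. left (right (right (?i a)))"])
      (auto intro!: poly_computable_intros poly_computable_input)
  have G: "poly_computable ?D ?i (\<lambda>a. enc_parts (parts (fst (fst a)) (snd (fst a)) (?G a)))"
    by (rule poly_computable_cong[where f = "\<lambda>a. right (right (right (?i a)))"])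
      (auto intro!: poly_computable_intros poly_computable_input)
  have "poly_computable ?D ?i (\<lambda>a. if enc_binop (fst (snd a)) = enc_binop (conn (fst (fst a)))
      then enc_parts (merge_parts (fst (fst a)) (snd (fst a))
        (parts (fst (fst a)) (snd (fst a)) (?F a)) (parts (fst (fst a)) (snd (fst a)) (?G a)))
      else enc_parts (single_part (snd (fst a)) (Bin (fst (snd a)) (?F a) (?G a))
        (Bin (fst (snd a)) (join_parts (fst (fst a)) (parts (fst (fst a)) (snd (fst a)) (?F a)))
           (join_parts (fst (fst a)) (parts (fst (fst a)) (snd (fst a)) (?G a))))))"
    by (intro poly_computable_If poly_computable_eq poly_computable_merge_parts
        poly_computable_single_part poly_computable_Bin poly_computable_join_parts poly_computable_conn
        parts_neq_None q x b B F G) auto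
  then show "poly_computable ?D ?i (\<lambda>(p, b, F, G). ?v p (Bin b F G))"
    by (rule poly_computable_cong) (simp add: split_beta)
next
  let ?ep = "\<lambda>p. Node (enc_quant (fst p)) (enc_nat (snd p))"
  let ?v = "\<lambda>p F. enc_parts (parts (fst p) (snd p) F)"
  let ?i = "\<lambda>(p, q, y, F). Node (?ep p) (Node (enc_fo (Qu q y F)) (?v p F))"
  let ?D = "{(p :: quant \<times> nat, q :: quant, y :: nat, F). pfo F}"
  let ?q' = "\<lambda>a. fst (snd a)" and ?y = "\<lambda>a. fst (snd (snd a))" and ?F = "\<lambda>a. snd (snd (snd a))"
  have q: "poly_computable ?D ?i (\<lambda>a. enc_quant (fst (fst a)))"
    by (rule poly_computable_cong[where f = "\<lambda>a. left (left (?i a))"])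
      (auto intro!: poly_computable_intros poly_computable_input)
  have x: "poly_computable ?D ?i (\<lambda>a. enc_nat (snd (fst a)))"
    by (rule poly_computable_cong[where f = "\<lambda>a. right (left (?i a))"])
      (auto intro!: poly_computable_intros poly_computable_input)
  have q': "poly_computable ?D ?i (\<lambda>a. enc_quant (?q' a))"
    by (rule poly_computable_cong[where f = "\<lambda>a. left (left (right (?i a)))"])
      (auto intro!: poly_computable_intros poly_computable_input)
  have y: "poly_computable ?D ?i (\<lambda>a. enc_nat (?y a))"
    by (rule poly_computable_cong[where f = "\<lambda>a. left (right (left (right (?i a))))"])
      (auto intro!: poly_computable_intros poly_computable_input)
  have B: "poly_computable ?D ?i (\<lambda>a. enc_fo (Qu (?q' a) (?y a) (?F a)))"
    by (rule poly_computable_cong[where f = "\<lambda>a. left (right (?i a))"])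
      (auto intro!: poly_computable_intros poly_computable_input)
  have F: "poly_computable ?D ?i (\<lambda>a. enc_parts (parts (fst (fst a)) (snd (fst a)) (?F a)))"
    by (rule poly_computable_cong[where f = "\<lambda>a. right (right (?i a))"])
      (auto intro!: poly_computable_intros poly_computable_input)
  have "poly_computable ?D ?i (\<lambda>a. if enc_quant (?q' a) = enc_quant (fst (fst a))
      then enc_parts (single_part (snd (fst a)) (Qu (?q' a) (?y a) (?F a))
        (Qu (?q' a) (?y a) (join_parts (fst (fst a)) (parts (fst (fst a)) (snd (fst a)) (?F a)))))
      else enc_parts (single_part (snd (fst a)) (Qu (?q' a) (?y a) (?F a))
        (Qu (fst (fst a)) (snd (fst a)) (Qu (?q' a) (?y a) (?F a)))))"
    by (intro poly_computable_If poly_computable_eq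
        poly_computable_single_part poly_computable_Qu[OF q' y] poly_computable_Qu[OF q x]
        poly_computable_join_parts parts_neq_None q q' x B F) auto
  then show "poly_computable ?D ?i (\<lambda>(p, q, y, F). ?v p (Qu q y F))"
    by (rule poly_computable_cong) (simp add: split_beta)
next
  let ?i = "\<lambda>(p, F). Node (Node (enc_quant (fst p)) (enc_nat (snd p))) (enc_fo F)"
  have "poly_bounded {(p, F). pfo F} ?i (\<lambda>a. 3 * nodes (?i a) + nodes (?i a) * (nodes (?i a) + 2) + 5)"
    by (intro poly_bounded_intros)
  then show "poly_bounded {(p, F). pfo F} ?i (\<lambda>(p, F). nodes (enc_parts (parts (fst p) (snd p) F)))"
  proof (rule poly_bounded_mono)
    fix a :: "(quant \<times> nat) \<times> fo" assume "a \<in> {(p, F). pfo F}"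
    moreover obtain q x F where [simp]: "a = ((q, x), F)" by (metis prod.exhaust)
    have "nodes (enc_fo F) * quant_size q x \<le> nodes (?i a) * (nodes (?i a) + 2)"
      by (intro mult_le_mono) (auto simp: quant_size_def)
    then have "nodes (enc_parts (parts q x F)) \<le> 3 * nodes (?i a) + nodes (?i a) * (nodes (?i a) + 2) + 5"
      using nodes_parts_le[of q x F] by simp
    ultimately show "a \<in> {(p, F). pfo F} \<and> (\<lambda>(p, F). nodes (enc_parts (parts (fst p) (snd p) F))) a
        \<le> 3 * nodes (?i a) + nodes (?i a) * (nodes (?i a) + 2) + 5" by simp
  qed
qed

lemma poly_computable_push:
  assumes "poly_computable D i (\<lambda>a. enc_quant (q a))" "poly_computable D i (\<lambda>a. enc_nat (x a))"
    "poly_computable D i (\<lambda>a. enc_fo (F a))" "\<And>a. a \<in> D \<Longrightarrow> pfo (F a)"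
  shows "poly_computable D i (\<lambda>a. enc_fo (push (q a) (x a) (F a)))"
proof -
  have "poly_computable D i
      (\<lambda>a. (\<lambda>(p, F). enc_parts (parts (fst p) (snd p) F)) ((\<lambda>a. ((q a, x a), F a)) a))"
    by (rule poly_computable_comp[OF _ poly_computable_parts_param])
      (use assms in \<open>auto intro: poly_computable_Node\<close>)
  then show ?thesis
    unfolding push_def by (intro poly_computable_join_parts parts_neq_None assms(1)) simp
qed

lemma atoms_nf: "atoms (nf F) = atoms F"
  by (induction F) (auto simp: atoms_push)

lemma pfo_nf: "pfo F \<Longrightarrow> pfo (nf F)"
  using normal_form_nf[of F] by (simp add: PFO_def)

text \<open>As \<open>nf\<close> keeps the number of atoms, each quantifier occurrence of
  \<open>F\<close> is charged at most once per atom in its scope. This gives the factor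
  \<open>atoms F\<close>, and the 1 stands for \<open>F\<close> itself.\<close>

lemma nodes_nf_le: "nodes (enc_fo (nf F)) \<le> nodes (enc_fo F) * (atoms F + 1)"
proof (induction F)
  case (Bin b F G)
  then show ?case by (simp add: algebra_simps)
next
  case (Qu q x F)
  have "nodes (enc_fo (nf (Qu q x F))) \<le> nodes (enc_fo (nf F)) + atoms F * quant_size q x"
    using nodes_push_le[of q x "nf F"] by (simp add: atoms_nf)
  also have "\<dots> \<le> nodes (enc_fo F) * (atoms F + 1) + atoms F * quant_size q x"
    using Qu by simp
  also have "\<dots> \<le> nodes (enc_fo (Qu q x F)) * (atoms (Qu q x F) + 1)"
    unfolding nodes_Qu by (simp add: algebra_simps)
  finally show ?case .
qed (auto simp: algebra_simps)

lemma poly_computable_nf: "poly_computable PFO enc_fo (\<lambda>F. enc_fo (nf F))"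
proof -
  \<comment> \<open>This recursion carries no parameter, so it gets the trivial one, encoded by
    \<open>Leaf\<close>.\<close>
  have "poly_computable {(p :: unit, F). pfo F} (\<lambda>(p, F). Node Leaf (enc_fo F)) (\<lambda>(p, F). enc_fo (nf F))"
  proof (rule poly_computable_fold)
    let ?i = "\<lambda>(p :: unit, R, xs). Node Leaf (enc_fo (Atom R xs))"
    show "poly_computable UNIV ?i (\<lambda>(p, R, xs). enc_fo (nf (Atom R xs)))"
      by (rule poly_computable_cong[where f = "\<lambda>a. right (?i a)"])
        (auto intro!: poly_computable_intros poly_computable_input)
  next
    let ?i = "\<lambda>(p :: unit, b, F, G). Node Leaf (Node (enc_fo (Bin b F G)) (Node (enc_fo (nf F)) (enc_fo (nf G))))"
    show "poly_computable {(p, b, F, G). pfo F \<and> pfo G} ?i (\<lambda>(p, b, F, G). enc_fo (nf (Bin b F G)))"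
      by (rule poly_computable_cong[where f = "\<lambda>a. Node (left (left (right (?i a)))) (right (right (?i a)))"])
        (auto intro!: poly_computable_intros poly_computable_input)
  next
    let ?i = "\<lambda>(p :: unit, q, x, F). Node Leaf (Node (enc_fo (Qu q x F)) (enc_fo (nf F)))"
    let ?D = "{(p :: unit, q :: quant, x :: nat, F). pfo F}"
    have "poly_computable ?D ?i (\<lambda>a. enc_quant (fst (snd a)))"
      by (rule poly_computable_cong[where f = "\<lambda>a. left (left (right (?i a)))"])
        (auto intro!: poly_computable_intros poly_computable_input)
    moreover have "poly_computable ?D ?i (\<lambda>a. enc_nat (fst (snd (snd a))))"
      by (rule poly_computable_cong[where f = "\<lambda>a. left (right (left (right (?i a))))"])
        (auto intro!: poly_computable_intros poly_computable_input)
    moreover have "poly_computable ?D ?i (\<lambda>a. enc_fo (nf (snd (snd (snd a)))))"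
      by (rule poly_computable_cong[where f = "\<lambda>a. right (right (?i a))"])
        (auto intro!: poly_computable_intros poly_computable_input)
    ultimately have "poly_computable ?D ?i
        (\<lambda>a. enc_fo (push (fst (snd a)) (fst (snd (snd a))) (nf (snd (snd (snd a))))))"
      by (rule poly_computable_push) (auto intro: pfo_nf)
    then show "poly_computable ?D ?i (\<lambda>(p, q, x, F). enc_fo (nf (Qu q x F)))"
      by (rule poly_computable_cong) auto
  next
    let ?i = "\<lambda>(p :: unit, F). Node Leaf (enc_fo F)"
    have "poly_bounded {(p, F). pfo F} ?i (\<lambda>a. nodes (?i a) * (nodes (?i a) + 1))"
      by (intro poly_bounded_intros)
    then show "poly_bounded {(p, F). pfo F} ?i (\<lambda>(p, F). nodes (enc_fo (nf F)))"
    proof (rule poly_bounded_mono)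
      fix a :: "unit \<times> fo" assume "a \<in> {(p, F). pfo F}"
      moreover obtain F where [simp]: "a = ((), F)" by (cases a) auto
      have "nodes (enc_fo F) * (atoms F + 1) \<le> nodes (?i a) * (nodes (?i a) + 1)"
        using atoms_le[of F] by (intro mult_le_mono) auto
      then have "nodes (enc_fo (nf F)) \<le> nodes (?i a) * (nodes (?i a) + 1)"
        using nodes_nf_le[of F] by (rule order_trans[rotated])
      ultimately show "a \<in> {(p, F). pfo F} \<and>
          (\<lambda>(p, F). nodes (enc_fo (nf F))) a \<le> nodes (?i a) * (nodes (?i a) + 1)" by simp
    qed
  qed
  then have "poly_computable PFO enc_fo (\<lambda>F. (\<lambda>(p, F). enc_fo (nf F)) ((\<lambda>F. ((), F)) F))"
    by (rule poly_computable_comp[rotated])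
      (auto simp: PFO_def intro!: poly_computable_intros poly_computable_input)
  then show ?thesis by simp
qed

theorem theorem4p2:
  "terminating system_Y \<and>
   (\<exists>p f. computes_in_poly_time enc_fo PFO p f \<and>
      (\<forall>\<phi>\<in>PFO. f \<phi> \<in> PFO \<and>
         normal_form_of system_Y (conv_class ACO \<phi>) (conv_class ACO (f \<phi>))))"
proof -
  obtain p where "computes_in_poly_time enc_fo PFO p nf"
    using poly_computable_nf by (rule poly_computable_imp_computes)
  then show ?thesis using terminating_Y normal_form_nf by blast
qed

end
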